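(* Let $(\mathcal{M},d)$ be a bounded, separable unique geodesic space, and suppose that for every pair $\alpha,\beta\in\mathcal{M}$ a geodesic transport map $\Gamma_{\alpha,\beta}:\mathcal{M}\to\mathcal{M}$ is given, assigning to each $\omega$ a unique point $\Gamma_{\alpha,\beta}(\omega)$. Let $(Y_{i,0},Y_{i,1},D_i)$, $i=1,\dots,n$, be i.i.d. copies of $(Y_0,Y_1,D)$ with $D\in\{0,1\}$, potential outcomes $Y_t(0),Y_t(1)\in\mathcal{M}$, $Y_0=Y_0(0)$, $Y_1=DY_1(1)+(1-D)Y_1(0)$. Write $\nu_{d,t}(a)=E_\oplus(Y_t(a)\mid D=d)$, $\nu_{d,t}=E_\oplus(Y_t\mid D=d)$, let $\tau=\gamma_{\nu_{1,1}(0),\nu_{1,1}(1)}$ be the GATT, and let $\nu_{1,1}'=\Gamma_{\nu_{0,0},\nu_{0,1}}(\nu_{1,0})$. Define the estimator $\hat\tau=\gamma_{\hat\nu_{1,1}',\hat\nu_{1,1}}$ with $\hat\nu_{1,1}'=\Gamma_{\hat\nu_{0,0},\hat\nu_{0,1}}(\hat\nu_{1,0})$, where for $t\in\{0,1\}$, \[\hat\nu_{0,t}=\operatorname{argmin}_{\omega\in\mathcal{M}}\frac{1}{n_0}\sum_{i=1}^n(1-D_i)d^2(Y_{i,t},\omega),\ n_0=\sum_i(1-D_i),\qquad \hat\nu_{1,t}=\operatorname{argmin}_{\omega\in\mathcal{M}}\frac{1}{n_1}\sum_{i=1}^nD_id^2(Y_{i,t},\omega),\ n_1=\sum_iD_i.\]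 Assume: (a) (parallel trends) $\Gamma_{\nu_{0,0}(0),\nu_{0,1}(0)}(\nu_{1,0}(0))=\nu_{1,1}(0)$; (b) there is $C_1>0$ with $d(\Gamma_{\alpha,\beta}(\omega),\Gamma_{\alpha,\beta}(\zeta))\le C_1d(\omega,\zeta)$ for all $\alpha,\beta,\omega,\zeta\in\mathcal{M}$; (c) there is $C_2>0$ with $d(\Gamma_{\alpha_1,\beta_1}(\omega),\Gamma_{\alpha_2,\beta_2}(\omega))\le C_2\{d(\alpha_1,\alpha_2)+d(\beta_1,\beta_2)\}$ for all $\alpha_1,\alpha_2,\beta_1,\beta_2,\omega\in\mathcal{M}$; (d) for each $d,t\in\{0,1\}$: (i) $\nu_{d,t}$ exists and is unique, $\hat\nu_{d,t}$ exists and is unique almost surely, and for every $\varepsilon>0$, $\inf_{d(\nu_{d,t},\omega)>\varepsilon}E\{d^2(Y_t,\omega)\mid D=d\}>E\{d^2(Y_t,\nu_{d,t})\mid D=d\}$; (ii) with $B_\delta(\nu_{d,t})$ the ball of radius $\delta$ about $\nu_{d,t}$ and $N(\epsilon,B_\delta(\nu_{d,t}),d)$ its $\epsilon$-covering number, $\int_0^1\sqrt{1+\log N(\delta\epsilon,B_\delta(\nu_{d,t}),d)}\,d\epsilon=O(1)$ as $\delta\to0$; (iii) there exist $\eta>0$, $C>0$ and $\kappa>1$ such that $E\{d^2(Y_t,\omega)\mid D=d\}-E\{d^2(Y_t,\nu_{d,t})\mid D=d\}\ge C\,d^\kappa(\nu_{d,t},\omega)$ whenever $d(\nu_{d,t},\omega)<\eta$;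 (e) there is $c\in(0,1/2]$ with $c\le P(D=1)\le1-c$. Then, with $d_{\mathcal{G}}$ taken with reference point $\omega_\oplus=\nu_{1,1}'$, \[d_{\mathcal{G}}(\hat\tau,\tau)=O_p\big(n^{-1/(2(\kappa-1))}\big).\]
   Context: A unique geodesic space is a metric space in which any two points $\alpha,\beta$ are joined by exactly one geodesic $\gamma_{\alpha,\beta}:[0,1]\to\mathcal{M}$ (constant-speed curve from $\alpha$ to $\beta$ of length $d(\alpha,\beta)$). The conditional Fréchet mean is $E_\oplus(Y\mid X)=\operatorname{argmin}_{\omega\in\mathcal{M}}E\{d^2(Y,\omega)\mid X\}$. Geodesics $\gamma_{\alpha_1,\beta_1},\gamma_{\alpha_2,\beta_2}$ are equivalent ($\sim$) iff $\Gamma_{\alpha_1,\beta_1}(\omega)=\Gamma_{\alpha_2,\beta_2}(\omega)$ for all $\omega\in\mathcal{M}$; on equivalence classes, for a fixed reference point $\omega_\oplus\in\mathcal{M}$, $d_{\mathcal{G}}([\gamma_{\alpha_1,\beta_1}],[\gamma_{\alpha_2,\beta_2}])=d(\Gamma_{\alpha_1,\beta_1}(\omega_\oplus),\Gamma_{\alpha_2,\beta_2}(\omega_\oplus))$, and $d_{\mathcal{G}}(\hat\tau,\tau)$ means $d_{\mathcal{G}}$ of their classes. *)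

theory Defs
  imports "HOL-Probability.Probability"
begin

definition is_geodesic :: "'m::metric_space \<Rightarrow> 'm \<Rightarrow> (real \<Rightarrow> 'm) \<Rightarrow> bool" where
  "is_geodesic a b g \<longleftrightarrow> g 0 = a \<and> g 1 = b \<and>
     (\<forall>s\<in>{0..1}. \<forall>t\<in>{0..1}. dist (g s) (g t) = \<bar>s - t\<bar> * dist a b)"

definition unique_geodesic_space :: "'m::metric_space itself \<Rightarrow> bool" where
  "unique_geodesic_space _ \<longleftrightarrow> (\<forall>a b::'m. \<exists>g. is_geodesic a b g \<and>
     (\<forall>g'. is_geodesic a b g' \<longrightarrow> (\<forall>t\<in>{0..1}. g' t = g t)))"

definition separable_space :: "'m::metric_space itself \<Rightarrow> bool" where
  "separable_space _ \<longleftrightarrow> (\<exists>S::'m set. countable S \<and> closure S = UNIV)"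

definition frechet_argmin :: "('m \<Rightarrow> real) \<Rightarrow> 'm" where
  "frechet_argmin F = (THE x. \<forall>y. F x \<le> F y)"

definition cond_mean_D :: "'a measure \<Rightarrow> ('a \<Rightarrow> bool) \<Rightarrow> bool \<Rightarrow> ('a \<Rightarrow> real) \<Rightarrow> real" where
  "cond_mean_D P D g f =
     (\<integral>\<omega>. indicator {\<omega>\<in>space P. D \<omega> = g} \<omega> * f \<omega> \<partial>P) / measure P {\<omega>\<in>space P. D \<omega> = g}"

definition cond_frechet_obj :: "'a measure \<Rightarrow> ('a \<Rightarrow> bool) \<Rightarrow> bool \<Rightarrow> ('a \<Rightarrow> 'm::metric_space) \<Rightarrow> 'm \<Rightarrow> real" where
  "cond_frechet_obj P D g Y x = cond_mean_D P D g (\<lambda>\<omega>. (dist (Y \<omega>) x)^2)"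

definition sample_obj :: "(nat \<Rightarrow> 'a \<Rightarrow> 'm::metric_space) \<Rightarrow> (nat \<Rightarrow> 'a \<Rightarrow> bool) \<Rightarrow> nat \<Rightarrow> bool \<Rightarrow> 'a \<Rightarrow> 'm \<Rightarrow> real" where
  "sample_obj Ys Ds n g \<omega> x =
     (1 / real (card {i. i < n \<and> Ds i \<omega> = g})) *
     (\<Sum>i<n. (if Ds i \<omega> = g then 1 else 0) * (dist (Ys i \<omega>) x)^2)"

text \<open>epsilon-covering number of S (value \<infinity> if no finite cover exists).\<close>
definition covering_number :: "'m::metric_space set \<Rightarrow> real \<Rightarrow> ennreal" where
  "covering_number S e = Inf {ennreal (real (card C)) | C. finite C \<and> S \<subseteq> (\<Union>c\<in>C. cball c e)}"

definition entropy_integrand :: "ennreal \<Rightarrow> ennreal" where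
  "entropy_integrand N = (if N = \<top> then \<top> else ennreal (sqrt (1 + ln (enn2real N))))"

definition entropy_integral :: "'m::metric_space \<Rightarrow> real \<Rightarrow> ennreal" where
  "entropy_integral \<nu> \<delta> =
     (\<integral>\<^sup>+ e. indicator {0..1} e * entropy_integrand (covering_number (ball \<nu> \<delta>) (\<delta> * e)) \<partial>lborel)"

text \<open>Outer probability (avoids measurability issues of the estimator).\<close>
definition outer_prob :: "'a measure \<Rightarrow> 'a set \<Rightarrow> real" where
  "outer_prob P S = Inf {measure P A | A. A \<in> sets P \<and> S \<subseteq> A}"

definition bigOp :: "'a measure \<Rightarrow> (nat \<Rightarrow> 'a \<Rightarrow> real) \<Rightarrow> (nat \<Rightarrow> real) \<Rightarrow> bool" where
  "bigOp P X r \<longleftrightarrow> (\<forall>\<epsilon>>0. \<exists>K N. \<forall>n\<ge>N.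
      outer_prob P {\<omega>\<in>space P. \<bar>X n \<omega>\<bar> > K * r n} \<le> \<epsilon>)"

text \<open>Metric on equivalence classes of geodesics (identified by endpoints) with reference point w0.\<close>
definition dG :: "('m::metric_space \<Rightarrow> 'm \<Rightarrow> 'm \<Rightarrow> 'm) \<Rightarrow> 'm \<Rightarrow> 'm \<times> 'm \<Rightarrow> 'm \<times> 'm \<Rightarrow> real" where
  "dG \<Gamma> w0 g1 g2 = dist (\<Gamma> (fst g1) (snd g1) w0) (\<Gamma> (fst g2) (snd g2) w0)"

definition obs_Y :: "('a \<Rightarrow> bool) \<Rightarrow> ('a \<Rightarrow> 'm) \<Rightarrow> ('a \<Rightarrow> 'm) \<Rightarrow> ('a \<Rightarrow> 'm) \<Rightarrow> bool \<Rightarrow> 'a \<Rightarrow> 'm" where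
  "obs_Y D Y00 Y10 Y11 t \<omega> = (if t then (if D \<omega> then Y11 \<omega> else Y10 \<omega>) else Y00 \<omega>)"

definition sample_Y :: "(nat \<Rightarrow> 'a \<Rightarrow> 'm \<times> 'm \<times> bool) \<Rightarrow> bool \<Rightarrow> nat \<Rightarrow> 'a \<Rightarrow> 'm" where
  "sample_Y Xs t i \<omega> = (if t then fst (snd (Xs i \<omega>)) else fst (Xs i \<omega>))"

definition sample_D :: "(nat \<Rightarrow> 'a \<Rightarrow> 'm \<times> 'm \<times> bool) \<Rightarrow> nat \<Rightarrow> 'a \<Rightarrow> bool" where
  "sample_D Xs i \<omega> = snd (snd (Xs i \<omega>))"

end

theory Submission
  imports Defs
begin

text \<open>
  The transport maps are Lipschitz in all arguments, so it suffices to bound the distance of each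
  sample Frechet mean to its population counterpart. Both minimise averages of
  \<open>f x = 1{D = g} \<cdot> d(Y, x)\<^sup>2\<close>, and \<open>x \<mapsto> f x\<close> is Lipschitz in the supremum norm because the space is
  bounded. Hence Hoeffding's lemma makes the increments of the centred empirical process subgaussian
  for the metric \<open>d\<close>, without symmetrisation, and chaining along dyadic covers bounds its oscillation
  on the ball of radius \<open>\<delta>\<close> by \<open>O(\<delta> / \<surd>n)\<close>. Balancing this against the curvature \<open>\<delta>\<^sup>\<kappa>\<close> on dyadic
  shells (peeling) gives the rate. Peeling starts only once the estimator is close to its target;
  this consistency needs no total boundedness, since a law on a separable space is concentrated, up
  to small mass, on finitely many small balls, over which the law of large numbers is uniform.
\<close>

section \<open>Covering numbers and the entropy integral\<close>

lemma covering_number_attained: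
  fixes S :: "'m::metric_space set"
  assumes "covering_number S e < \<top>"
  obtains C where "finite C" "S \<subseteq> (\<Union>c\<in>C. cball c e)" "covering_number S e = ennreal (real (card C))"
proof -
  define F where "F = {C. finite C \<and> S \<subseteq> (\<Union>c\<in>C. cball c e)}"
  have eq: "covering_number S e = (INF C\<in>F. ennreal (real (card C)))"
    unfolding covering_number_def F_def by (rule arg_cong[where f = Inf]) auto
  have "F \<noteq> {}"
    using assms eq by force
  then obtain C0 where "C0 \<in> F" by blast
  define C where "C = arg_min_on card F"
  have C: "C \<in> F" and min: "\<And>C'. C' \<in> F \<Longrightarrow> card C \<le> card C'"
    using arg_min_nat_lemma[of "\<lambda>C. C \<in> F" C0 card] \<open>C0 \<in> F\<close>
    by (auto simp: C_def arg_min_on_def)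
  have "covering_number S e = ennreal (real (card C))"
    unfolding eq using C min
    by (intro antisym INF_lower INF_greatest ennreal_leI) auto
  then show thesis
    using C that by (auto simp: F_def)
qed

lemma covering_number_antimono:
  assumes "e \<le> e'"
  shows "covering_number S e' \<le> covering_number S e"
proof -
  have "cball c e \<subseteq> cball c e'" for c :: 'a
    using assms by auto
  then have "(\<Union>c\<in>C. cball c e) \<subseteq> (\<Union>c\<in>C. cball c e')" for C :: "'a set"
    by blast
  then have "S \<subseteq> (\<Union>c\<in>C. cball c e')" if "S \<subseteq> (\<Union>c\<in>C. cball c e)" for C
    using that by (rule order_trans[rotated])
  then show ?thesis
    unfolding covering_number_def by (intro Inf_superset_mono Collect_mono ex_mono) simp
qed

lemma covering_number_ge_1:
  assumes "S \<noteq> {}"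
  shows "1 \<le> covering_number S e"
  unfolding covering_number_def
proof (intro Inf_greatest, clarify)
  fix C assume "finite C" "S \<subseteq> (\<Union>c\<in>C. cball c e)"
  then have "card C \<noteq> 0" using assms by auto
  then show "1 \<le> ennreal (real (card C))" by simp
qed

lemma entropy_integrand_mono:
  assumes "1 \<le> a" "a \<le> b"
  shows "entropy_integrand a \<le> entropy_integrand b"
proof (cases "b = \<top>")
  case False
  then have "b < \<top>" using top.not_eq_extremum by blast
  then have "a < \<top>" using assms by order
  have "1 \<le> enn2real a" "enn2real a \<le> enn2real b"
    using assms \<open>a < \<top>\<close> \<open>b < \<top>\<close> enn2real_mono[of 1 a] enn2real_mono[of a b] by simp_all
  then show ?thesis
    using False \<open>a < \<top>\<close> by (auto simp: entropy_integrand_def intro!: ennreal_leI)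
qed (simp add: entropy_integrand_def)

lemma entropy_integral_ge_dyadic_sum:
  fixes \<nu> :: "'m::metric_space"
  assumes "\<delta> > 0"
  shows "(\<Sum>k<m. ennreal ((1/2)^(Suc k)) * entropy_integrand (covering_number (ball \<nu> \<delta>) (\<delta> * (1/2)^k)))
     \<le> entropy_integral \<nu> \<delta>"
proof -
  let ?I = "\<lambda>k::nat. {(1/2)^(Suc k)<..(1/2::real)^k}"
  let ?a = "\<lambda>k. entropy_integrand (covering_number (ball \<nu> \<delta>) (\<delta> * (1/2)^k))"
  let ?g = "\<lambda>e. indicator {0..1} e * entropy_integrand (covering_number (ball \<nu> \<delta>) (\<delta> * e))"
  have len: "(1/2::real)^k - (1/2)^(Suc k) = (1/2)^(Suc k)" for k by simp
  have disj: "j = k" if "e \<in> ?I j" "e \<in> ?I k" for e j k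
  proof (rule ccontr)
    assume "j \<noteq> k"
    then consider "Suc j \<le> k" | "Suc k \<le> j" by linarith
    then show False
    proof cases
      case 1
      then have "(1/2::real)^k \<le> (1/2)^(Suc j)" by (intro power_decreasing) auto
      then show False using that by auto
    next
      case 2
      then have "(1/2::real)^j \<le> (1/2)^(Suc k)" by (intro power_decreasing) auto
      then show False using that by auto
    qed
  qed
  have pt: "?a k \<le> ?g e" if "e \<in> ?I k" for e k
  proof -
    have "(1/2::real)^k \<le> 1" "(0::real) < (1/2)^(Suc k)" by (auto simp: power_le_one)
    then have "0 < e" "e \<le> 1" using that by auto
    moreover have "?a k \<le> entropy_integrand (covering_number (ball \<nu> \<delta>) (\<delta> * e))"
      using that assms
      by (intro entropy_integrand_mono covering_number_ge_1 covering_number_antimono) auto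
    ultimately show ?thesis by simp
  qed
  have "(\<Sum>k<m. ennreal ((1/2)^(Suc k)) * ?a k) = (\<Sum>k<m. \<integral>\<^sup>+ e. ?a k * indicator (?I k) e \<partial>lborel)"
  proof (intro sum.cong refl)
    fix k
    have "(1/2::real)^(Suc k) \<le> (1/2)^k" by (intro power_decreasing) auto
    then have "emeasure lborel (?I k) = ennreal ((1/2)^(Suc k))"
      by (simp only: emeasure_lborel_Ioc len)
    then show "ennreal ((1/2)^(Suc k)) * ?a k = (\<integral>\<^sup>+ e. ?a k * indicator (?I k) e \<partial>lborel)"
      by (subst nn_integral_cmult_indicator) (simp_all only: mult.commute, simp)
  qed
  also have "\<dots> = (\<integral>\<^sup>+ e. (\<Sum>k<m. ?a k * indicator (?I k) e) \<partial>lborel)"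
    by (intro nn_integral_sum[symmetric]) auto
  also have "\<dots> \<le> entropy_integral \<nu> \<delta>"
    unfolding entropy_integral_def
  proof (intro nn_integral_mono)
    fix e :: real
    show "(\<Sum>k<m. ?a k * indicator (?I k) e) \<le> ?g e"
    proof (cases "\<exists>k<m. e \<in> ?I k")
      case True
      then obtain k where k: "k < m" "e \<in> ?I k" by blast
      have "(\<Sum>j<m. ?a j * indicator (?I j) e) = (\<Sum>j<m. if j = k then ?a k else 0)"
      proof (intro sum.cong refl)
        fix j
        show "?a j * indicator (?I j) e = (if j = k then ?a k else 0)"
        proof (cases "j = k")
          case True
          then show ?thesis using k(2) by (simp only: indicator_simps(1) if_True mult_1_right refl simp_thms)
        next
          case False
          then have "e \<notin> ?I j" using disj[OF _ k(2)] by blast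
          then show ?thesis using False by (simp only: indicator_simps(2) if_False mult_zero_right simp_thms)
        qed
      qed
      also have "\<dots> = ?a k" using k(1) by simp
      finally show ?thesis using pt[OF k(2)] by (simp only:)
    next
      case False
      have "(\<Sum>j<m. ?a j * indicator (?I j) e) = 0"
      proof (intro sum.neutral ballI)
        fix j assume "j \<in> {..<m}"
        then have "e \<notin> ?I j" using False by blast
        then show "?a j * indicator (?I j) e = 0" by (simp only: indicator_simps(2) mult_zero_right simp_thms)
      qed
      then show ?thesis by (simp only: zero_le)
    qed
  qed
  finally show ?thesis .
qed

lemma dyadic_covers:
  fixes \<nu> :: "'m::metric_space"
  assumes \<delta>: "\<delta> > 0" and K: "entropy_integral \<nu> \<delta> \<le> ennreal K" and "K \<ge> 0"
  obtains C :: "nat \<Rightarrow> 'm set" where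
    "C 0 = {\<nu>}" "\<forall>k. finite (C k)" "\<forall>k. card (C k) \<ge> 1"
    "\<forall>k. ball \<nu> \<delta> \<subseteq> (\<Union>c\<in>C k. cball c (\<delta> * (1/2)^k))"
    "\<forall>k. card (C k) \<le> card (C (Suc k))"
    "\<forall>m. (\<Sum>k<m. (1/2)^(Suc k) * sqrt (1 + ln (real (card (C k))))) \<le> K"
proof -
  let ?N = "\<lambda>k. covering_number (ball \<nu> \<delta>) (\<delta> * (1/2)^k)"
  have sums: "(\<Sum>k<m. ennreal ((1/2)^(Suc k)) * entropy_integrand (?N k)) \<le> ennreal K" for m
    using entropy_integral_ge_dyadic_sum[OF \<delta>, where m = m and \<nu> = \<nu>] K by (rule order_trans)
  have fin: "?N k < \<top>" for k
  proof (rule ccontr)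
    assume "\<not> ?N k < \<top>"
    then have "?N k = \<top>" using top.not_eq_extremum by blast
    then have "ennreal ((1/2)^(Suc k)) * entropy_integrand (?N k) = \<top>"
      by (simp add: entropy_integrand_def ennreal_mult_top)
    then have "(\<Sum>k<Suc k. ennreal ((1/2)^(Suc k)) * entropy_integrand (?N k)) = \<top>"
      by (simp only: sum.lessThan_Suc add_top_right_ennreal ennreal_add_eq_top)
    then show False using sums[of "Suc k"] by (simp only: top_unique ennreal_neq_top)
  qed
  have ge1: "1 \<le> ?N k" for k using \<delta> by (intro covering_number_ge_1) auto
  have "\<forall>k. \<exists>C. finite C \<and> ball \<nu> \<delta> \<subseteq> (\<Union>c\<in>C. cball c (\<delta> * (1/2)^k)) \<and> ?N k = ennreal (real (card C))"
  proof
    fix k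
    from covering_number_attained[OF fin[of k]]
    obtain C where "finite C" "ball \<nu> \<delta> \<subseteq> (\<Union>c\<in>C. cball c (\<delta> * (1/2)^k))" "?N k = ennreal (real (card C))" .
    then show "\<exists>C. finite C \<and> ball \<nu> \<delta> \<subseteq> (\<Union>c\<in>C. cball c (\<delta> * (1/2)^k)) \<and> ?N k = ennreal (real (card C))"
      by (intro exI[of _ C] conjI)
  qed
  from choice[OF this] obtain C where *: "\<forall>k. finite (C k) \<and> ball \<nu> \<delta> \<subseteq> (\<Union>c\<in>C k. cball c (\<delta> * (1/2)^k)) \<and>
      ?N k = ennreal (real (card (C k)))" ..
  note C = *[THEN spec, THEN conjunct1] *[THEN spec, THEN conjunct2, THEN conjunct1]
    *[THEN spec, THEN conjunct2, THEN conjunct2]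
  have c1: "card (C k) \<ge> 1" for k using ge1[of k] by (simp add: C(3))
  have "?N 0 \<le> ennreal (real (card {\<nu>}))"
    unfolding covering_number_def
  proof (intro Inf_lower CollectI exI[of _ "{\<nu>}"] conjI refl)
    show "ball \<nu> \<delta> \<subseteq> (\<Union>c\<in>{\<nu>}. cball c (\<delta> * (1/2)^0))" by auto
  qed simp
  then have c0: "card (C 0) = 1" using c1[of 0] C(3)[of 0] by simp
  have mono: "card (C k) \<le> card (C (Suc k))" for k
  proof -
    have "?N k \<le> ?N (Suc k)" using \<delta> by (intro covering_number_antimono) simp
    then show ?thesis by (simp only: C(3)) simp
  qed
  define C' where "C' = (\<lambda>k. if k = 0 then {\<nu>} else C k)"
  have card': "card (C' k) = card (C k)" for k using c0 by (simp add: C'_def)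
  have real_sums: "(\<Sum>k<m. (1/2)^(Suc k) * sqrt (1 + ln (real (card (C k))))) \<le> K" for m
  proof -
    have "ennreal (\<Sum>k<m. (1/2)^(Suc k) * sqrt (1 + ln (real (card (C k)))))
        = (\<Sum>k<m. ennreal ((1/2)^(Suc k) * sqrt (1 + ln (real (card (C k))))))"
    proof (intro sum_ennreal[symmetric])
      fix k
      have "1 \<le> real (card (C k))" using c1[of k] by simp
      then show "0 \<le> (1/2)^(Suc k) * sqrt (1 + ln (real (card (C k))))" by simp
    qed
    also have "\<dots> = (\<Sum>k<m. ennreal ((1/2)^(Suc k)) * entropy_integrand (?N k))"
    proof (intro sum.cong refl)
      fix k
      have "1 \<le> real (card (C k))" using c1[of k] by simp
      then show "ennreal ((1/2)^(Suc k) * sqrt (1 + ln (real (card (C k))))) =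
          ennreal ((1/2)^(Suc k)) * entropy_integrand (?N k)"
        by (simp add: C(3) entropy_integrand_def ennreal_mult del: power_Suc)
    qed
    also have "\<dots> \<le> ennreal K" by (rule sums)
    finally show ?thesis using \<open>K \<ge> 0\<close> by (simp add: ennreal_le_iff)
  qed
  show thesis
  proof (rule that[of C']; (intro allI)?)
    show "ball \<nu> \<delta> \<subseteq> (\<Union>c\<in>C' k. cball c (\<delta> * (1/2)^k))" for k
    proof (cases "k = 0")
      case True
      then show ?thesis by (auto simp: C'_def)
    next
      case False
      then show ?thesis using C(2)[of k] by (simp only: C'_def if_False)
    qed
    show "finite (C' k)" for k using C(1) by (simp add: C'_def)
    show "C' 0 = {\<nu>}" by (simp add: C'_def)
    show "card (C' k) \<ge> 1" for k unfolding card' by (rule c1)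
    show "card (C' k) \<le> card (C' (Suc k))" for k unfolding card' by (rule mono)
    show "(\<Sum>k<m. (1/2)^(Suc k) * sqrt (1 + ln (real (card (C' k))))) \<le> K" for m
      unfolding card' by (rule real_sums)
  qed
qed

section \<open>Subgaussian maximal inequality\<close>

text \<open>
  Here, as in all maximal inequalities below, the supremum is replaced by a measurable dominating
  variable \<open>S\<close> with controlled expectation, which avoids measurability questions for suprema. The
  choice of \<open>S\<close> rests on \<open>l \<bar>X\<bar> - a \<le> exp (l \<bar>X\<bar> - a) \<le> exp (l X - a) + exp (- l X - a)\<close>.
\<close>

lemma (in prob_space) subgaussian_family_dominated:
  fixes X :: "'i \<Rightarrow> 'a \<Rightarrow> real"
  assumes I: "finite I" "real (card I) \<le> n" and n: "n \<ge> 1" and s: "s > 0"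
    and [measurable]: "\<And>i. i \<in> I \<Longrightarrow> X i \<in> borel_measurable M"
    and exp: "\<And>i l. i \<in> I \<Longrightarrow> (\<integral>\<^sup>+\<omega>. ennreal (exp (l * X i \<omega>)) \<partial>M) \<le> ennreal (exp (l\<^sup>2 * s\<^sup>2 / 2))"
  obtains S where "integrable M S" "\<forall>\<omega>. 0 \<le> S \<omega>" "\<forall>i\<in>I. \<forall>\<omega>. \<bar>X i \<omega>\<bar> \<le> S \<omega>"
    "expectation S \<le> 3 * s * sqrt (1 + ln n)"
proof -
  define A where "A = sqrt (1 + ln n)"
  have A: "A \<ge> 1" and A2: "A\<^sup>2 = 1 + ln n" using n by (auto simp: A_def)
  define l where "l = A / s"
  have l: "l > 0" using A s by (simp add: l_def)
  define a where "a = ln (2 * n) + l\<^sup>2 * s\<^sup>2 / 2"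
  have ls: "l\<^sup>2 * s\<^sup>2 = A\<^sup>2" using s by (simp add: l_def power_divide)
  have "ln (2::real) \<le> 1" using ln_2_less_1 by simp
  then have a_le: "a \<le> 3/2 * A\<^sup>2" using n unfolding a_def ls A2 by (simp add: ln_mult field_simps)
  have a0: "a \<ge> 0" using n by (simp add: a_def)
  have ea: "exp (-a) * (2 * n * exp (l\<^sup>2 * s\<^sup>2 / 2)) = 1"
    using n by (simp add: a_def exp_minus exp_add exp_diff)
  define T where "T = (\<lambda>\<omega>. \<Sum>i\<in>I. exp (l * X i \<omega>) + exp (- l * X i \<omega>))"
  define S where "S = (\<lambda>\<omega>. (a + exp (-a) * T \<omega>) / l)"
  have [measurable]: "T \<in> borel_measurable M" unfolding T_def by measurable
  have T0: "T \<omega> \<ge> 0" for \<omega> unfolding T_def by (intro sum_nonneg add_nonneg_nonneg) auto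
  have T_int: "(\<integral>\<^sup>+\<omega>. ennreal (T \<omega>) \<partial>M) \<le> ennreal (2 * n * exp (l\<^sup>2 * s\<^sup>2 / 2))"
  proof -
    have "(\<integral>\<^sup>+\<omega>. ennreal (T \<omega>) \<partial>M) =
        (\<integral>\<^sup>+\<omega>. (\<Sum>i\<in>I. ennreal (exp (l * X i \<omega>)) + ennreal (exp (- l * X i \<omega>))) \<partial>M)"
      unfolding T_def by (intro nn_integral_cong) (simp add: sum_ennreal[symmetric] add_nonneg_nonneg del: sum_ennreal)
    also have "\<dots> = (\<Sum>i\<in>I. (\<integral>\<^sup>+\<omega>. ennreal (exp (l * X i \<omega>)) + ennreal (exp (- l * X i \<omega>)) \<partial>M))"
      by (intro nn_integral_sum) auto
    also have "\<dots> = (\<Sum>i\<in>I. (\<integral>\<^sup>+\<omega>. ennreal (exp (l * X i \<omega>)) \<partial>M) + (\<integral>\<^sup>+\<omega>. ennreal (exp (- l * X i \<omega>)) \<partial>M))"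
      by (intro sum.cong refl nn_integral_add) auto
    also have "\<dots> \<le> (\<Sum>i\<in>I. ennreal (exp (l\<^sup>2 * s\<^sup>2 / 2)) + ennreal (exp (l\<^sup>2 * s\<^sup>2 / 2)))"
      using exp[of _ l] exp[of _ "-l"] by (intro sum_mono add_mono) auto
    also have "\<dots> = ennreal (real (card I) * (2 * exp (l\<^sup>2 * s\<^sup>2 / 2)))"
      by (simp add: ennreal_mult ennreal_of_nat_eq_real_of_nat flip: ennreal_plus)
    also have "\<dots> \<le> ennreal (2 * n * exp (l\<^sup>2 * s\<^sup>2 / 2))"
      using I(2) by (intro ennreal_leI) (simp add: mult_right_mono)
    finally show ?thesis .
  qed
  have intT: "integrable M T"
    using T0 order_le_less_trans[OF T_int ennreal_less_top] by (intro integrableI_nonneg) auto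
  have ET: "expectation T \<le> 2 * n * exp (l\<^sup>2 * s\<^sup>2 / 2)"
    using T_int nn_integral_eq_integral[OF intT] T0 n by (simp add: ennreal_le_iff)
  show thesis
  proof (rule that[of S]; (intro allI ballI)?)
    show "integrable M S" unfolding S_def using intT by auto
    show "0 \<le> S \<omega>" for \<omega> using T0[of \<omega>] a0 l by (simp add: S_def)
    show "\<bar>X i \<omega>\<bar> \<le> S \<omega>" if i: "i \<in> I" for i \<omega>
    proof -
      have "l * \<bar>X i \<omega>\<bar> - a \<le> exp (l * \<bar>X i \<omega>\<bar> - a)"
        using exp_ge_add_one_self[of "l * \<bar>X i \<omega>\<bar> - a"] by linarith
      also have "\<dots> = exp (-a) * exp (l * \<bar>X i \<omega>\<bar>)" by (simp add: exp_diff exp_minus field_simps)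
      also have "\<dots> \<le> exp (-a) * T \<omega>"
      proof (intro mult_left_mono)
        have "exp (l * \<bar>X i \<omega>\<bar>) \<le> exp (l * X i \<omega>) + exp (- l * X i \<omega>)"
          by (cases "X i \<omega> \<ge> 0") auto
        also have "\<dots> \<le> T \<omega>" unfolding T_def
          by (rule member_le_sum[OF i]) (auto simp: I add_nonneg_nonneg)
        finally show "exp (l * \<bar>X i \<omega>\<bar>) \<le> T \<omega>" .
      qed auto
      finally show ?thesis using l by (simp add: S_def field_simps)
    qed
    have "expectation S = (a + exp (-a) * expectation T) / l"
      unfolding S_def using intT by (simp add: prob_space)
    also have "\<dots> \<le> (a + 1) / l"
      using l mult_left_mono[OF ET, of "exp (-a)"] ea by (intro divide_right_mono) auto
    also have "\<dots> \<le> (3 * A\<^sup>2) / l"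
    proof -
      have "1 \<le> A\<^sup>2" using A by (simp add: one_le_power)
      then show ?thesis using a_le l by (intro divide_right_mono) auto
    qed
    also have "\<dots> = 3 * s * A" using A s by (simp add: l_def power2_eq_square field_simps)
    finally show "expectation S \<le> 3 * s * sqrt (1 + ln n)" by (simp add: A_def)
  qed
qed

section \<open>Chaining for empirical averages\<close>

locale iid_sample = prob_space P for P :: "'a measure" +
  fixes N Q :: "'b measure" and X :: "nat \<Rightarrow> 'a \<Rightarrow> 'b"
  assumes X_measurable [measurable]: "\<And>i. X i \<in> measurable P N"
    and X_indep: "indep_vars (\<lambda>_. N) X UNIV"
    and X_law: "\<And>i. distr P N (X i) = Q"
begin

sublocale law: prob_space Q
  using X_law[of 0] prob_space_distr[OF X_measurable[of 0]] by simp

lemma sets_law [measurable_cong]: "sets Q = sets N"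
  using X_law[of 0] sets_distr by metis

definition dev :: "nat \<Rightarrow> ('b \<Rightarrow> real) \<Rightarrow> 'a \<Rightarrow> real" where
  "dev n f \<omega> = (\<Sum>i<n. f (X i \<omega>)) / real n - (\<integral>z. f z \<partial>Q)"

lemma dev_measurable [measurable]:
  assumes [measurable]: "f \<in> borel_measurable N"
  shows "dev n f \<in> borel_measurable P"
proof -
  have "(\<lambda>\<omega>. f (X i \<omega>)) \<in> borel_measurable P" for i by measurable
  then show ?thesis unfolding dev_def by simp
qed

lemma law_integrable:
  fixes f :: "'b \<Rightarrow> real"
  assumes "f \<in> borel_measurable N" "\<And>z. \<bar>f z\<bar> \<le> b"
  shows "integrable Q f"
  using assms by (intro law.integrable_const_bound[of _ b]) (auto simp: measurable_cong_sets[OF sets_law])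

lemma dev_diff:
  assumes "integrable Q f" "integrable Q g"
  shows "dev n (\<lambda>z. f z - g z) \<omega> = dev n f \<omega> - dev n g \<omega>"
  using assms by (simp add: dev_def sum_subtractf diff_divide_distrib)

lemma dev_sum:
  assumes "\<And>k. k \<in> K \<Longrightarrow> integrable Q (f k)"
  shows "dev n (\<lambda>z. \<Sum>k\<in>K. a k * f k z) \<omega> = (\<Sum>k\<in>K. a k * dev n (f k) \<omega>)"
proof -
  have "(\<Sum>i<n. \<Sum>k\<in>K. a k * f k (X i \<omega>)) / real n = (\<Sum>k\<in>K. a k * ((\<Sum>i<n. f k (X i \<omega>)) / real n))"
    by (subst sum.swap) (simp add: sum_distrib_left sum_divide_distrib)
  moreover have "(\<integral>z. (\<Sum>k\<in>K. a k * f k z) \<partial>Q) = (\<Sum>k\<in>K. a k * (\<integral>z. f k z \<partial>Q))"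
    using assms by (subst Bochner_Integration.integral_sum) auto
  ultimately show ?thesis
    by (simp add: dev_def right_diff_distrib sum_subtractf)
qed

lemma abs_dev_le:
  assumes "integrable Q u" "integrable Q v" "\<And>z. \<bar>u z\<bar> \<le> v z"
  shows "\<bar>dev n u \<omega>\<bar> \<le> dev n v \<omega> + 2 * (\<integral>z. v z \<partial>Q)"
proof -
  have "\<bar>(\<Sum>i<n. u (X i \<omega>)) / real n\<bar> \<le> (\<Sum>i<n. v (X i \<omega>)) / real n"
    by (auto simp: abs_divide intro!: divide_right_mono order_trans[OF sum_abs] sum_mono assms(3))
  moreover have "\<bar>\<integral>z. u z \<partial>Q\<bar> \<le> (\<integral>z. v z \<partial>Q)"
    using assms by (intro order_trans[OF integral_abs_bound] integral_mono) auto
  ultimately show ?thesis unfolding dev_def by linarith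
qed

lemma dev_exp_moment:
  assumes [measurable]: "f \<in> borel_measurable N" and b: "\<And>z. \<bar>f z\<bar> \<le> b" and n: "n > 0"
  shows "(\<integral>\<^sup>+\<omega>. ennreal (exp (l * dev n f \<omega>)) \<partial>P) \<le> ennreal (exp (l\<^sup>2 * (b / sqrt n)\<^sup>2 / 2))"
proof -
  have pos: "(\<integral>\<^sup>+\<omega>. ennreal (exp (l * dev n f \<omega>)) \<partial>P) \<le> ennreal (exp (l\<^sup>2 * (b / sqrt n)\<^sup>2 / 2))"
    if [measurable]: "f \<in> borel_measurable N" and b: "\<And>z. \<bar>f z\<bar> \<le> b" and l: "l > 0" for f l
  proof -
    define \<mu> where "\<mu> = (\<integral>z. f z \<partial>Q)"
    define h where "h = l / real n"
    have h: "h > 0" using l n by (simp add: h_def)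
    have mean: "expectation (\<lambda>\<omega>. f (X i \<omega>)) = \<mu>" for i
      unfolding \<mu>_def X_law[of i, symmetric] by (subst integral_distr) auto
    have "l * dev n f \<omega> = (\<Sum>i<n. h * (f (X i \<omega>) - \<mu>))" for \<omega>
    proof -
      have "(\<Sum>i<n. h * (f (X i \<omega>) - \<mu>)) = h * ((\<Sum>i<n. f (X i \<omega>)) - real n * \<mu>)"
        by (simp add: sum_subtractf flip: sum_distrib_left)
      also have "\<dots> = l * dev n f \<omega>" using n by (simp add: h_def dev_def \<mu>_def field_simps)
      finally show ?thesis by simp
    qed
    then have "(\<integral>\<^sup>+\<omega>. ennreal (exp (l * dev n f \<omega>)) \<partial>P) =
        (\<integral>\<^sup>+\<omega>. (\<Prod>i<n. ennreal (exp (h * (f (X i \<omega>) - \<mu>)))) \<partial>P)"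
      by (simp add: exp_sum prod_ennreal)
    also have "\<dots> = (\<Prod>i<n. \<integral>\<^sup>+\<omega>. ennreal (exp (h * (f (X i \<omega>) - \<mu>))) \<partial>P)"
      by (intro indep_vars_nn_integral
          indep_vars_compose2[where Y = "\<lambda>_ z. ennreal (exp (h * (f z - \<mu>)))" and X = X and M' = "\<lambda>_. N"]
          indep_vars_subset[OF X_indep]) auto
    also have "\<dots> \<le> (\<Prod>i<n. ennreal (exp (h\<^sup>2 * (b - (-b))\<^sup>2 / 8)))"
    proof (intro prod_mono_ennreal)
      fix i
      interpret interval_bounded_random_variable P "\<lambda>\<omega>. f (X i \<omega>)" "-b" b
        by unfold_locales (use b in \<open>auto simp: abs_le_iff minus_le_iff\<close>)
      show "(\<integral>\<^sup>+\<omega>. ennreal (exp (h * (f (X i \<omega>) - \<mu>))) \<partial>P) \<le> ennreal (exp (h\<^sup>2 * (b - (-b))\<^sup>2 / 8))"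
        using Hoeffdings_lemma_nn_integral[OF h] by (simp add: mean)
    qed
    also have "\<dots> = ennreal (exp (real n * (h\<^sup>2 * (b - (-b))\<^sup>2 / 8)))"
      by (simp add: ennreal_power flip: exp_of_nat_mult)
    also have "real n * (h\<^sup>2 * (b - (-b))\<^sup>2 / 8) = l\<^sup>2 * (b / sqrt n)\<^sup>2 / 2"
      using n by (simp add: h_def power_divide) (simp add: power2_eq_square mult_ac)
    finally show ?thesis .
  qed
  consider "l > 0" | "l = 0" | "l < 0" by linarith
  then show ?thesis
  proof cases
    case 1
    then show ?thesis using pos b by simp
  next
    case 2
    then show ?thesis by (simp add: emeasure_space_1)
  next
    case 3
    have "dev n (\<lambda>z. - f z) \<omega> = - dev n f \<omega>" for \<omega>
      by (simp add: dev_def sum_negf)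
    then show ?thesis using pos[of "\<lambda>z. - f z" "-l"] 3 b by simp
  qed
qed

lemma dev_family_dominated:
  fixes f :: "'i \<Rightarrow> 'b \<Rightarrow> real"
  assumes I: "finite I" "real (card I) \<le> m" "m \<ge> 1" and b: "b > 0" and n: "n > 0"
    and f: "\<And>i. i \<in> I \<Longrightarrow> f i \<in> borel_measurable N" "\<And>i z. i \<in> I \<Longrightarrow> \<bar>f i z\<bar> \<le> b"
  obtains S where "integrable P S" "\<forall>\<omega>. 0 \<le> S \<omega>" "\<forall>i\<in>I. \<forall>\<omega>. \<bar>dev n (f i) \<omega>\<bar> \<le> S \<omega>"
    "expectation S \<le> 3 * b * sqrt (1 + ln m) / sqrt (real n)"
proof -
  have "b / sqrt n > 0" using b n by simp
  then obtain S where "integrable P S" "\<forall>\<omega>. 0 \<le> S \<omega>" "\<forall>i\<in>I. \<forall>\<omega>. \<bar>dev n (f i) \<omega>\<bar> \<le> S \<omega>"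
    "expectation S \<le> 3 * (b / sqrt n) * sqrt (1 + ln m)"
  proof (rule subgaussian_family_dominated[OF I])
    show "dev n (f i) \<in> borel_measurable P" if "i \<in> I" for i
      using f(1)[OF that] by (rule dev_measurable)
    show "(\<integral>\<^sup>+\<omega>. ennreal (exp (l * dev n (f i) \<omega>)) \<partial>P) \<le> ennreal (exp (l\<^sup>2 * (b / sqrt n)\<^sup>2 / 2))"
      if "i \<in> I" for i l
      using that by (intro dev_exp_moment f n)
  qed
  then show thesis using that[of S] by simp
qed

lemma abs_dev_le_const:
  assumes "integrable Q u" "\<And>z. \<bar>u z\<bar> \<le> b" "n > 0"
  shows "\<bar>dev n u \<omega>\<bar> \<le> 2 * b"
  using abs_dev_le[of u "\<lambda>_. b" n \<omega>] assms by (simp add: dev_def law.prob_space)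

lemma chaining_maximal_inequality:
  fixes f :: "'m::metric_space \<Rightarrow> 'b \<Rightarrow> real"
  assumes meas: "\<And>x. f x \<in> borel_measurable N" and bdd: "\<And>x z. \<bar>f x z\<bar> \<le> B"
    and lip: "\<And>x y z. \<bar>f x z - f y z\<bar> \<le> L * dist x y" and L: "L > 0"
    and \<delta>: "\<delta> > 0" and K: "entropy_integral \<nu> \<delta> \<le> ennreal K" "K \<ge> 0" and n: "n > 0"
  obtains S where "integrable P S" "\<forall>\<omega>. 0 \<le> S \<omega>"
    "\<forall>x\<in>ball \<nu> \<delta>. \<forall>\<omega>. \<bar>dev n (f x) \<omega> - dev n (f \<nu>) \<omega>\<bar> \<le> S \<omega>"
    "expectation S \<le> (48 * K + 1) * L * \<delta> / sqrt (real n)"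
proof -
  note int = law_integrable[OF meas bdd]
  obtain C :: "nat \<Rightarrow> 'm set" where C0: "C 0 = {\<nu>}" and fin': "\<forall>k. finite (C k)"
    and card1': "\<forall>k. card (C k) \<ge> 1"
    and cover': "\<forall>k. ball \<nu> \<delta> \<subseteq> (\<Union>c\<in>C k. cball c (\<delta> * (1/2)^k))"
    and card_mono': "\<forall>k. card (C k) \<le> card (C (Suc k))"
    and sums': "\<forall>m. (\<Sum>k<m. (1/2)^(Suc k) * sqrt (1 + ln (real (card (C k))))) \<le> K"
    using dyadic_covers[OF \<delta> K] .
  note fin = fin'[rule_format] and card1 = card1'[rule_format] and cover = cover'[rule_format]
    and card_mono = card_mono'[rule_format] and sums = sums'[rule_format]
  define r where "r k = \<delta> * (1/2)^k" for k :: nat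
  have r0: "r k > 0" and r_Suc: "r (Suc k) = r k / 2" for k using \<delta> by (simp_all add: r_def)
  define a where "a k = sqrt (1 + ln (real (card (C k))))" for k
  define I where "I k = {p \<in> C (Suc k) \<times> C k. dist (fst p) (snd p) \<le> 2 * r k}" for k
  let ?good = "\<lambda>k T. integrable P T \<and> (\<forall>\<omega>. 0 \<le> T \<omega>) \<and>
    (\<forall>p\<in>I k. \<forall>\<omega>. \<bar>dev n (\<lambda>z. f (fst p) z - f (snd p) z) \<omega>\<bar> \<le> T \<omega>) \<and>
    expectation T \<le> 12 * L * r k * a (Suc k) / sqrt (real n)"
  have "\<forall>k. \<exists>T. ?good k T"
  proof
    fix k
    let ?c = "real (card (C (Suc k)))"
    have c1: "?c \<ge> 1" using card1[of "Suc k"] by simp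
    have finI: "finite (I k)" unfolding I_def using fin by simp
    have "card (I k) \<le> card (C (Suc k) \<times> C k)"
      unfolding I_def using fin by (intro Finite_Set.card_mono) auto
    also have "\<dots> \<le> card (C (Suc k)) * card (C (Suc k))"
      using card_mono[of k] by (simp add: card_cartesian_product)
    finally have "real (card (I k)) \<le> ?c\<^sup>2"
      unfolding power2_eq_square by (metis of_nat_le_iff of_nat_mult)
    then obtain T where T: "integrable P T" "\<forall>\<omega>. 0 \<le> T \<omega>"
      "\<forall>p\<in>I k. \<forall>\<omega>. \<bar>dev n (\<lambda>z. f (fst p) z - f (snd p) z) \<omega>\<bar> \<le> T \<omega>"
      "expectation T \<le> 3 * (L * (2 * r k)) * sqrt (1 + ln (?c\<^sup>2)) / sqrt (real n)"
    proof (rule dev_family_dominated[OF finI, where b = "L * (2 * r k)" and n = n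
          and f = "\<lambda>p z. f (fst p) z - f (snd p) z"])
      show "1 \<le> ?c\<^sup>2" using c1 by (simp add: one_le_power)
      show "0 < L * (2 * r k)" using L r0 by simp
      show "(\<lambda>z. f (fst p) z - f (snd p) z) \<in> borel_measurable N" for p
        using meas by simp
      fix p z assume "p \<in> I k"
      then have "L * dist (fst p) (snd p) \<le> L * (2 * r k)" using L by (simp add: I_def)
      then show "\<bar>f (fst p) z - f (snd p) z\<bar> \<le> L * (2 * r k)" using lip order_trans by blast
    qed (use n in auto)
    have "sqrt (1 + ln (?c\<^sup>2)) \<le> 2 * a (Suc k)"
    proof (rule real_le_lsqrt)
      show "1 + ln (?c\<^sup>2) \<le> (2 * a (Suc k))\<^sup>2"
        using c1 by (simp add: a_def ln_realpow)
    qed (use c1 in \<open>simp_all add: a_def\<close>)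
    then have "3 * (L * (2 * r k)) * sqrt (1 + ln (?c\<^sup>2)) / sqrt (real n)
        \<le> 3 * (L * (2 * r k)) * (2 * a (Suc k)) / sqrt (real n)"
      using L r0[of k] by (intro divide_right_mono mult_left_mono) auto
    also have "\<dots> = 12 * L * r k * a (Suc k) / sqrt (real n)" by simp
    finally have "expectation T \<le> 12 * L * r k * a (Suc k) / sqrt (real n)"
      using T(4) by (rule order_trans[rotated])
    then show "\<exists>T. ?good k T" using T by (intro exI[of _ T]) simp
  qed
  from choice[OF this] obtain T where T: "\<And>k. ?good k (T k)" by auto
  define m where "m = Suc n"
  define S where "S \<omega> = (\<Sum>k<m. T k \<omega>) + 2 * (L * r m)" for \<omega>
  show thesis
  proof (rule that[of S]; (intro allI ballI)?)
    show "integrable P S" unfolding S_def using T by (intro Bochner_Integration.integrable_add Bochner_Integration.integrable_sum) auto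
    show "0 \<le> S \<omega>" for \<omega>
      unfolding S_def using T L r0[of m] by (intro add_nonneg_nonneg sum_nonneg) auto
    fix x \<omega> assume x: "x \<in> ball \<nu> \<delta>"
    have "\<forall>k. \<exists>c. c \<in> C k \<and> dist c x \<le> r k"
    proof
      fix k
      have "x \<in> (\<Union>c\<in>C k. cball c (\<delta> * (1/2)^k))" using cover x by (rule subsetD)
      then show "\<exists>c. c \<in> C k \<and> dist c x \<le> r k" by (auto simp: r_def)
    qed
    from choice[OF this] obtain p where p: "\<And>k. p k \<in> C k" "\<And>k. dist (p k) x \<le> r k" by auto
    have p0: "p 0 = \<nu>" using p(1)[of 0] C0 by simp
    have link: "\<bar>dev n (f (p (Suc k))) \<omega> - dev n (f (p k)) \<omega>\<bar> \<le> T k \<omega>" for k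
    proof -
      have "dist (p (Suc k)) (p k) \<le> r (Suc k) + r k"
        using dist_triangle3[of "p (Suc k)" "p k" x] p(2)[of k] p(2)[of "Suc k"] by (simp add: dist_commute)
      also have "\<dots> \<le> 2 * r k" using r0[of k] by (simp add: r_Suc)
      finally have "(p (Suc k), p k) \<in> I k" using p(1) by (simp add: I_def)
      then have "\<bar>dev n (\<lambda>z. f (p (Suc k)) z - f (p k) z) \<omega>\<bar> \<le> T k \<omega>" using T[of k] by force
      then show ?thesis by (simp add: dev_diff[OF int int])
    qed
    have "dev n (f (p m)) \<omega> - dev n (f \<nu>) \<omega> = (\<Sum>k<m. dev n (f (p (Suc k))) \<omega> - dev n (f (p k)) \<omega>)"
      using sum_lessThan_telescope[of "\<lambda>k. dev n (f (p k)) \<omega>" m] by (simp add: p0)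
    also have "\<bar>\<dots>\<bar> \<le> (\<Sum>k<m. T k \<omega>)"
      by (rule order_trans[OF sum_abs]) (intro sum_mono link)
    finally have 1: "\<bar>dev n (f (p m)) \<omega> - dev n (f \<nu>) \<omega>\<bar> \<le> (\<Sum>k<m. T k \<omega>)" .
    have "\<bar>f x z - f (p m) z\<bar> \<le> L * r m" for z
    proof -
      have "L * dist x (p m) \<le> L * r m" using L p(2)[of m] by (simp add: dist_commute)
      then show ?thesis using lip order_trans by blast
    qed
    then have "\<bar>dev n (\<lambda>z. f x z - f (p m) z) \<omega>\<bar> \<le> 2 * (L * r m)"
      using int n by (intro abs_dev_le_const) auto
    then have 2: "\<bar>dev n (f x) \<omega> - dev n (f (p m)) \<omega>\<bar> \<le> 2 * (L * r m)"
      by (simp add: dev_diff[OF int int])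
    show "\<bar>dev n (f x) \<omega> - dev n (f \<nu>) \<omega>\<bar> \<le> S \<omega>"
      unfolding S_def using 1 2 by linarith
  next
    have "expectation S = (\<Sum>k<m. expectation (T k)) + 2 * (L * r m)"
      unfolding S_def using T by (subst Bochner_Integration.integral_add) (auto simp: prob_space)
    also have "(\<Sum>k<m. expectation (T k)) \<le> (\<Sum>k<m. 12 * L * r k * a (Suc k) / sqrt (real n))"
      using T by (intro sum_mono) auto
    also have "\<dots> = 48 * L * \<delta> / sqrt (real n) * (\<Sum>k<m. (1/2)^(Suc (Suc k)) * a (Suc k))"
      by (simp add: sum_distrib_left r_def field_simps)
    also have "\<dots> \<le> 48 * L * \<delta> / sqrt (real n) * K"
    proof (intro mult_left_mono)
      have "(\<Sum>k<m. (1/2)^(Suc (Suc k)) * a (Suc k)) \<le> (\<Sum>k<Suc m. (1/2)^(Suc k) * a k)"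
        unfolding sum.lessThan_Suc_shift using card1[of 0] by (simp add: a_def C0)
      also have "\<dots> \<le> K" using sums[of "Suc m"] by (simp only: a_def)
      finally show "(\<Sum>k<m. (1/2)^(Suc (Suc k)) * a (Suc k)) \<le> K" .
    qed (use L \<delta> in simp)
    also have "2 * (L * r m) \<le> L * \<delta> / sqrt (real n)"
    proof -
      have "sqrt (real n) \<le> real n" using n by (intro real_le_lsqrt) (auto simp: power2_eq_square)
      also have "\<dots> \<le> 2 ^ n" by (simp add: of_nat_less_two_power less_imp_le)
      finally have "(1/2)^n \<le> 1 / sqrt (real n)"
        using n by (simp add: power_one_over field_simps)
      then have "L * \<delta> * (1/2)^n \<le> L * \<delta> * (1 / sqrt (real n))"
        using L \<delta> by (intro mult_left_mono) auto
      then show ?thesis by (simp add: r_def m_def)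
    qed
    finally show "expectation S \<le> (48 * K + 1) * L * \<delta> / sqrt (real n)"
      by (simp add: algebra_simps add_divide_distrib)
  qed
qed

end

section \<open>Uniform law of large numbers for distances\<close>

lemma measurable_dist_to_point [measurable (raw)]:
  fixes Y :: "'a \<Rightarrow> 'm::metric_space"
  assumes "Y \<in> borel_measurable M"
  shows "(\<lambda>z. dist (Y z) x) \<in> borel_measurable M"
proof (rule measurable_compose[OF assms])
  show "(\<lambda>y. dist y x) \<in> borel_measurable borel"
    by (intro borel_measurable_continuous_onI continuous_intros)
qed

lemma abs_power2_diff_le:
  fixes u w :: real
  assumes "\<bar>u - w\<bar> \<le> e" "0 \<le> u" "u \<le> B" "0 \<le> w" "w \<le> B"
  shows "\<bar>u\<^sup>2 - w\<^sup>2\<bar> \<le> 2 * B * e"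
proof -
  have "\<bar>u\<^sup>2 - w\<^sup>2\<bar> = \<bar>u - w\<bar> * (u + w)"
    using assms by (simp add: power2_eq_square square_diff_square_factored abs_mult mult.commute)
  also have "\<dots> \<le> e * (2 * B)" using assms by (intro mult_mono) auto
  finally show ?thesis by (simp add: mult_ac)
qed

lemma separable_space_dense_sequence:
  assumes "separable_space TYPE('m::metric_space)"
  obtains c :: "nat \<Rightarrow> 'm::metric_space" where "\<forall>e>0. \<forall>y. \<exists>k. dist y (c k) < e"
proof -
  from assms obtain S :: "'m set" where S: "countable S" "closure S = UNIV"
    unfolding separable_space_def by blast
  have "\<exists>k. dist y (from_nat_into S k) < e" if "e > 0" for e y
  proof -
    have "y \<in> closure S" using S by simp
    then obtain s where "s \<in> S" "dist s y < e" using \<open>e > 0\<close> closure_approachable[of y S] by blast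
    moreover obtain k where "from_nat_into S k = s"
      using from_nat_into_surj[OF S(1) \<open>s \<in> S\<close>] by blast
    ultimately show ?thesis by (auto simp: dist_commute)
  qed
  then show thesis using that by blast
qed

context iid_sample
begin

lemma uniform_law_of_large_numbers_dist:
  fixes Y :: "'b \<Rightarrow> 'm::metric_space"
  assumes Y [measurable]: "Y \<in> borel_measurable N" and G [measurable]: "G \<in> sets N"
    and sep: "separable_space TYPE('m)" and B: "B > 0" "\<And>a b::'m. dist a b \<le> B" and "e > 0"
  shows "\<exists>A\<ge>0. \<forall>n>0. \<exists>S. integrable P S \<and> (\<forall>\<omega>. 0 \<le> S \<omega>) \<and>
    (\<forall>x \<omega>. \<bar>dev n (\<lambda>z. indicator G z * (dist (Y z) x)\<^sup>2) \<omega>\<bar> \<le> e + S \<omega>) \<and>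
    expectation S \<le> A / sqrt (real n)"
proof -
  define e0 where "e0 = e / (4 * B + 2 * B\<^sup>2)"
  have "4 * B + 2 * B\<^sup>2 > 0" using B by (simp add: add_pos_pos)
  then have e0: "e0 > 0" and e0_eq: "4 * B * e0 + 2 * B\<^sup>2 * e0 = e"
    using \<open>e > 0\<close> unfolding e0_def by (simp, simp add: add_divide_distrib[symmetric] distrib_right[symmetric] del: distrib_right)
  obtain c :: "nat \<Rightarrow> 'm" where c: "\<forall>e>0. \<forall>y. \<exists>k. dist y (c k) < e"
    using separable_space_dense_sequence[OF sep] .
  define R where "R m = {z\<in>space N. z \<in> G \<and> (\<forall>j<m. \<not> dist (Y z) (c j) < e0)}" for m :: nat
  define A where "A k = {z\<in>space N. z \<in> G \<and> dist (Y z) (c k) < e0 \<and> (\<forall>j<k. \<not> dist (Y z) (c j) < e0)}" for k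
  have R [measurable]: "R m \<in> sets N" for m unfolding R_def by measurable
  have A [measurable]: "A k \<in> sets N" for k unfolding A_def by measurable
  have "(\<lambda>m. measure Q (R m)) \<longlonglongrightarrow> measure Q (\<Inter>m. R m)"
    by (intro law.finite_Lim_measure_decseq) (auto simp: decseq_def R_def sets_law intro!: R[unfolded R_def])
  moreover have "(\<Inter>m. R m) = {}"
  proof (intro equals0I)
    fix z assume z: "z \<in> (\<Inter>m. R m)"
    from c e0 obtain k where "dist (Y z) (c k) < e0" by blast
    moreover have "z \<in> R (Suc k)" using z by blast
    ultimately show False by (auto simp: R_def)
  qed
  ultimately have "(\<lambda>m. measure Q (R m)) \<longlonglongrightarrow> 0" by simp
  then have "eventually (\<lambda>m. measure Q (R m) < e0) sequentially" using e0 by (rule order_tendstoD)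
  then obtain m where m: "measure Q (R m) < e0" by (auto simp: eventually_sequentially)
  define f where "f x z = indicator G z * (dist (Y z) x)\<^sup>2" for x z
  define h where "h x z = (\<Sum>k<m. (dist (c k) x)\<^sup>2 * indicator (A k) z)" for x z
  have sq: "0 \<le> (dist a b)\<^sup>2" "(dist a b)\<^sup>2 \<le> B\<^sup>2" for a b :: 'm
    using B(2)[of a b] by (auto intro: power_mono)
  have approx: "\<bar>f x z - h x z\<bar> \<le> 2 * B * e0 + B\<^sup>2 * indicator (R m) z" for x z
  proof (cases "z \<in> G \<and> z \<notin> R m")
    case True
    have zN: "z \<in> space N" using True sets.sets_into_space[OF G] by blast
    then have ex: "\<exists>j<m. dist (Y z) (c j) < e0" using True by (auto simp: R_def)
    define k where "k = (LEAST j. dist (Y z) (c j) < e0)"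
    have k: "dist (Y z) (c k) < e0" and kmin: "\<And>j. dist (Y z) (c j) < e0 \<Longrightarrow> k \<le> j"
      unfolding k_def using ex by (auto intro: LeastI Least_le)
    have km: "k < m" using ex kmin by (auto intro: le_less_trans)
    have "z \<in> A j \<longleftrightarrow> j = k" for j
      using True zN k kmin by (auto simp: A_def not_less[symmetric]) (metis kmin le_neq_implies_less)
    then have "h x z = (\<Sum>j<m. if j = k then (dist (c k) x)\<^sup>2 else 0)"
      unfolding h_def by (intro sum.cong) (auto simp: indicator_def)
    also have "\<dots> = (dist (c k) x)\<^sup>2" using km by simp
    finally have "\<bar>f x z - h x z\<bar> = \<bar>(dist (Y z) x)\<^sup>2 - (dist (c k) x)\<^sup>2\<bar>" using True by (simp add: f_def)
    also have "\<dots> \<le> 2 * B * e0"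
      using k B(2) abs_dist_diff_le[of "Y z" x "c k"]
      by (intro abs_power2_diff_le) (auto simp: dist_commute[of _ x])
    finally show ?thesis using True by simp
  next
    case False
    then have "h x z = 0"
      unfolding h_def by (intro sum.neutral) (auto simp: indicator_def A_def R_def)
    moreover have "\<bar>f x z\<bar> \<le> B\<^sup>2 * indicator (R m) z"
      using False sq by (auto simp: f_def indicator_def)
    ultimately show ?thesis using B e0 by (simp add: add_increasing)
  qed
  have [measurable]: "f x \<in> borel_measurable N" for x
    unfolding f_def by measurable
  have int_f: "integrable Q (f x)" for x
    by (rule law_integrable[of _ "B\<^sup>2"]) (use sq in \<open>auto simp: f_def indicator_def\<close>)
  have int_ind: "integrable Q (indicator S :: _ \<Rightarrow> real)" if "S \<in> sets N" for S
    using that by (intro law_integrable[of _ 1]) (auto simp: indicator_def)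
  have int_h: "integrable Q (h x)" for x
    unfolding h_def by (intro Bochner_Integration.integrable_sum integrable_mult_right int_ind A)
  define v where "v z = 2 * B * e0 + B\<^sup>2 * indicator (R m) z" for z
  have int_v: "integrable Q v" unfolding v_def using int_ind[OF R] by auto
  have v_mean: "(\<integral>z. v z \<partial>Q) = 2 * B * e0 + B\<^sup>2 * measure Q (R m)"
    unfolding v_def using int_ind[OF R, of m]
    by (subst Bochner_Integration.integral_add) (auto simp: law.prob_space sets_law)
  have dev_v: "dev n v \<omega> = B\<^sup>2 * dev n (indicator (R m)) \<omega>" if "n > 0" for n \<omega>
    using that int_ind[OF R, of m] unfolding dev_def v_mean
    by (simp add: v_def sum.distrib sets_law add_divide_distrib right_diff_distrib flip: sum_distrib_left)
  define g :: "nat \<Rightarrow> 'b \<Rightarrow> real" where "g k = (if k < m then indicator (A k) else indicator (R m))" for k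
  define A0 where "A0 = B\<^sup>2 * real (Suc m) * (3 * sqrt (1 + ln (real (Suc m))))"
  show ?thesis
  proof (intro exI[of _ A0] conjI allI impI)
    show "A0 \<ge> 0" by (simp add: A0_def)
    fix n :: nat assume n: "n > 0"
    obtain S where S: "integrable P S" "\<forall>\<omega>. 0 \<le> S \<omega>" "\<forall>k\<in>{..m}. \<forall>\<omega>. \<bar>dev n (g k) \<omega>\<bar> \<le> S \<omega>"
      "expectation S \<le> 3 * 1 * sqrt (1 + ln (real (Suc m))) / sqrt (real n)"
      by (rule dev_family_dominated[of "{..m}" "real (Suc m)" 1 n g])
        (use n in \<open>auto simp: g_def indicator_def\<close>)
    show "\<exists>S. integrable P S \<and> (\<forall>\<omega>. 0 \<le> S \<omega>) \<and>
      (\<forall>x \<omega>. \<bar>dev n (\<lambda>z. indicator G z * (dist (Y z) x)\<^sup>2) \<omega>\<bar> \<le> e + S \<omega>) \<and>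
      expectation S \<le> A0 / sqrt (real n)"
    proof (intro exI[of _ "\<lambda>\<omega>. B\<^sup>2 * real (Suc m) * S \<omega>"] conjI allI)
      show "integrable P (\<lambda>\<omega>. B\<^sup>2 * real (Suc m) * S \<omega>)" using S(1) by simp
      show "0 \<le> B\<^sup>2 * real (Suc m) * S \<omega>" for \<omega> using S(2) by simp
      have "B\<^sup>2 * real (Suc m) * expectation S \<le>
          B\<^sup>2 * real (Suc m) * (3 * 1 * sqrt (1 + ln (real (Suc m))) / sqrt (real n))"
        by (intro mult_left_mono S) simp
      then show "expectation (\<lambda>\<omega>. B\<^sup>2 * real (Suc m) * S \<omega>) \<le> A0 / sqrt (real n)"
        unfolding A0_def by (simp add: mult_ac)
      fix x \<omega>
      have "dev n (h x) \<omega> = (\<Sum>k<m. (dist (c k) x)\<^sup>2 * dev n (indicator (A k)) \<omega>)"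
        unfolding h_def using int_ind[OF A] by (intro dev_sum)
      also have "\<bar>\<dots>\<bar> \<le> (\<Sum>k<m. B\<^sup>2 * S \<omega>)"
      proof (rule order_trans[OF sum_abs], intro sum_mono)
        fix k assume "k \<in> {..<m}"
        then have "\<bar>dev n (indicator (A k)) \<omega>\<bar> \<le> S \<omega>" using S(3)[rule_format, of k \<omega>] by (simp add: g_def)
        then show "\<bar>(dist (c k) x)\<^sup>2 * dev n (indicator (A k)) \<omega>\<bar> \<le> B\<^sup>2 * S \<omega>"
          unfolding abs_mult using sq by (intro mult_mono) auto
      qed
      finally have 1: "\<bar>dev n (h x) \<omega>\<bar> \<le> real m * (B\<^sup>2 * S \<omega>)" by simp
      have "\<bar>dev n (indicator (R m)) \<omega>\<bar> \<le> S \<omega>" using S(3)[rule_format, of m \<omega>] by (simp add: g_def)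
      then have 2: "B\<^sup>2 * dev n (indicator (R m)) \<omega> \<le> B\<^sup>2 * S \<omega>"
        by (intro mult_left_mono) auto
      have "B\<^sup>2 * measure Q (R m) \<le> B\<^sup>2 * e0" using m by (intro mult_left_mono) auto
      moreover have "\<bar>dev n (\<lambda>z. f x z - h x z) \<omega>\<bar> \<le> dev n v \<omega> + 2 * (\<integral>z. v z \<partial>Q)"
        using int_f int_h int_v approx by (intro abs_dev_le) (auto simp: v_def)
      ultimately have "\<bar>dev n (f x) \<omega> - dev n (h x) \<omega>\<bar> \<le> B\<^sup>2 * S \<omega> + e"
        using 2 unfolding dev_diff[OF int_f int_h] dev_v[OF n] v_mean by (simp add: e0_eq[symmetric])
      then have "\<bar>dev n (f x) \<omega>\<bar> \<le> e + (real m * (B\<^sup>2 * S \<omega>) + B\<^sup>2 * S \<omega>)" using 1 by linarith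
      also have "real m * (B\<^sup>2 * S \<omega>) + B\<^sup>2 * S \<omega> = B\<^sup>2 * real (Suc m) * S \<omega>" by (simp add: algebra_simps)
      finally show "\<bar>dev n (\<lambda>z. indicator G z * (dist (Y z) x)\<^sup>2) \<omega>\<bar> \<le> e + B\<^sup>2 * real (Suc m) * S \<omega>"
        by (simp add: f_def[abs_def])
    qed
  qed
qed

end

section \<open>Rates of convergence by peeling\<close>

lemma dyadic_shell:
  fixes u t :: real
  assumes "u > 0" "u \<le> t"
  obtains j :: nat where "2 ^ j * u \<le> t" "t < 2 ^ Suc j * u"
proof -
  obtain n :: nat where "t / u < 2 ^ n" using real_arch_pow[of 2 "t / u"] by auto
  then have ex: "t < 2 ^ n * u" using assms by (simp add: field_simps)
  define i where "i = (LEAST i. t < 2 ^ i * u)"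
  have i: "t < 2 ^ i * u" unfolding i_def using ex by (rule LeastI)
  have "i \<noteq> 0" using i assms by (intro notI) simp
  then obtain j where j: "i = Suc j" by (cases i) auto
  have "\<not> t < 2 ^ j * u" using not_less_Least[of j "\<lambda>i. t < 2 ^ i * u"] j unfolding i_def by simp
  then show thesis using that[of j] i j by simp
qed

context iid_sample
begin

lemma m_estimator_rate:
  fixes f :: "'m::metric_space \<Rightarrow> 'b \<Rightarrow> real" and \<nu> :: 'm
  defines "F \<equiv> \<lambda>x. \<integral>z. f x z \<partial>Q"
  assumes meas: "\<And>x. f x \<in> borel_measurable N" and bdd: "\<And>x z. \<bar>f x z\<bar> \<le> B"
    and lip: "\<And>x y z. \<bar>f x z - f y z\<bar> \<le> L * dist x y" and L: "L > 0"
    and ulln: "\<And>e. e > 0 \<Longrightarrow> \<exists>A\<ge>0. \<forall>n>0. \<exists>S. integrable P S \<and> (\<forall>\<omega>. 0 \<le> S \<omega>) \<and>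
      (\<forall>x \<omega>. \<bar>dev n (f x) \<omega>\<bar> \<le> e + S \<omega>) \<and> expectation S \<le> A / sqrt (real n)"
    and separation: "\<And>e. e > 0 \<Longrightarrow> \<exists>b>0. \<forall>x. dist \<nu> x > e \<longrightarrow> F x - F \<nu> \<ge> b"
    and entropy: "eventually (\<lambda>\<delta>. entropy_integral \<nu> \<delta> \<le> ennreal K) (at_right 0)"
    and \<kappa>: "\<kappa> > 1"
    and curvature: "\<eta> > 0" "C > 0" "\<And>x. dist \<nu> x < \<eta> \<Longrightarrow> F x - F \<nu> \<ge> C * dist \<nu> x powr \<kappa>"
    and \<epsilon>: "\<epsilon> > 0"
  shows "\<exists>K n0. K \<ge> 0 \<and> (\<forall>n\<ge>n0. \<exists>E\<in>sets P. prob E \<le> \<epsilon> \<and>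
    (\<forall>\<omega>\<in>space P - E. \<forall>x. (\<Sum>i<n. f x (X i \<omega>)) \<le> (\<Sum>i<n. f \<nu> (X i \<omega>)) \<longrightarrow>
       dist \<nu> x \<le> K * real n powr (- 1 / (2 * (\<kappa> - 1)))))"
proof -
  define K' where "K' = max K 0"
  have K'0: "K' \<ge> 0" by (simp add: K'_def)
  obtain \<delta>0 where \<delta>0: "\<delta>0 > 0" "\<And>\<delta>. 0 < \<delta> \<Longrightarrow> \<delta> < \<delta>0 \<Longrightarrow> entropy_integral \<nu> \<delta> \<le> ennreal K"
    using entropy unfolding eventually_at_right_field by blast
  have ent: "entropy_integral \<nu> \<delta> \<le> ennreal K'" if "0 < \<delta>" "\<delta> < \<delta>0" for \<delta>
    using \<delta>0(2)[OF that] by (rule order_trans) (auto simp: K'_def intro: ennreal_leI)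
  define \<rho> where "\<rho> = min \<delta>0 \<eta> / 4"
  have \<rho>: "\<rho> > 0" "2 * \<rho> < \<delta>0" "\<rho> < \<eta>" using \<delta>0(1) curvature(1) by (auto simp: \<rho>_def)
  obtain b where b: "b > 0" "\<And>x. dist \<nu> x > \<rho> \<Longrightarrow> F x - F \<nu> \<ge> b"
    using separation[OF \<rho>(1)] by blast
  from ulln[of "b / 4"] b(1) obtain A where A: "A \<ge> 0"
    "\<forall>n>0. \<exists>S. integrable P S \<and> (\<forall>\<omega>. 0 \<le> S \<omega>) \<and>
      (\<forall>x \<omega>. \<bar>dev n (f x) \<omega>\<bar> \<le> b / 4 + S \<omega>) \<and> expectation S \<le> A / sqrt (real n)"
    by auto
  define M0 where "M0 = (48 * K' + 1) * L"
  have M0: "M0 > 0" using K'0 L by (simp add: M0_def)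
  define q where "q = (2::real) powr (1 - \<kappa>)"
  have q: "0 < q" "q < 1" using \<kappa> powr_less_mono[of "1 - \<kappa>" 0 2] by (auto simp: q_def)
  define W where "W = 4 * M0 / (C * \<epsilon> * (1 - q))"
  have W: "W > 0" using M0 curvature(2) \<epsilon> q by (simp add: W_def)
  define K0 where "K0 = W powr (1 / (\<kappa> - 1))"
  have K0: "K0 > 0" using W by (simp add: K0_def)
  have K0_powr: "K0 powr (1 - \<kappa>) = 1 / W"
  proof -
    have "1 / (\<kappa> - 1) * (1 - \<kappa>) = -1" using \<kappa> by (simp add: field_simps)
    then show ?thesis using W by (simp add: K0_def powr_powr powr_minus_divide)
  qed
  define n0 where "n0 = Suc (nat \<lceil>(8 * A / (b * \<epsilon>))\<^sup>2\<rceil>)"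
  show ?thesis
  proof (intro exI[of _ K0] exI[of _ n0] conjI allI impI)
    show "K0 \<ge> 0" using K0 by simp
    fix n assume "n \<ge> n0"
    then have n: "n > 0" by (simp add: n0_def)
    have sqrt_n: "8 * A / (b * \<epsilon>) \<le> sqrt (real n)"
    proof (rule real_le_rsqrt)
      have "(8 * A / (b * \<epsilon>))\<^sup>2 \<le> real (nat \<lceil>(8 * A / (b * \<epsilon>))\<^sup>2\<rceil>)" by (rule real_nat_ceiling_ge)
      also have "\<dots> \<le> real n" using \<open>n \<ge> n0\<close> by (simp add: n0_def)
      finally show "(8 * A / (b * \<epsilon>))\<^sup>2 \<le> real n" .
    qed
    define r where "r = real n powr (- 1 / (2 * (\<kappa> - 1)))"
    have r: "r > 0" using n by (simp add: r_def)
    have r_powr: "r powr (1 - \<kappa>) = sqrt (real n)"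
    proof -
      have e: "- 1 / (2 * (\<kappa> - 1)) * (1 - \<kappa>) = 1 / 2" using \<kappa> by (simp add: field_simps)
      show ?thesis unfolding r_def powr_powr e using n by (simp add: powr_half_sqrt)
    qed
    define u where "u = K0 * r"
    have u: "u > 0" using K0 r by (simp add: u_def)

    obtain S1 where S1: "integrable P S1" "\<forall>\<omega>. 0 \<le> S1 \<omega>" "\<forall>x \<omega>. \<bar>dev n (f x) \<omega>\<bar> \<le> b / 4 + S1 \<omega>"
      "expectation S1 \<le> A / sqrt (real n)" using A(2) n by blast
    define E1 where "E1 = {\<omega>\<in>space P. S1 \<omega> \<ge> b / 4}"
    have [measurable]: "S1 \<in> borel_measurable P" using S1(1) by simp
    have E1 [measurable]: "E1 \<in> sets P" unfolding E1_def by measurable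
    have "prob E1 \<le> expectation S1 / (b / 4)"
      unfolding E1_def using S1 b(1) by (intro integral_Markov_inequality_measure[where A = "{}"]) auto
    also have "\<dots> \<le> A / sqrt (real n) / (b / 4)" using S1(4) b(1) by (intro divide_right_mono) auto
    also have "\<dots> \<le> \<epsilon> / 2"
    proof -
      have "8 * A \<le> sqrt (real n) * (b * \<epsilon>)" using sqrt_n b(1) \<epsilon> by (simp add: pos_divide_le_eq)
      then show ?thesis using n b(1) by (simp add: field_simps)
    qed
    finally have prob_E1: "prob E1 \<le> \<epsilon> / 2" .

    obtain m :: nat where "\<rho> / u < 2 ^ m" using real_arch_pow[of 2 "\<rho> / u"] by auto
    then have m: "\<rho> < 2 ^ m * u" using u by (simp add: field_simps)
    define J where "J = {j. j < m \<and> 2 ^ Suc j * u < \<delta>0}"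
    have finJ: "finite J" by (simp add: J_def)
    let ?good = "\<lambda>j S. j \<in> J \<longrightarrow> integrable P S \<and> (\<forall>\<omega>. 0 \<le> S \<omega>) \<and>
      (\<forall>x\<in>ball \<nu> (2 ^ Suc j * u). \<forall>\<omega>. \<bar>dev n (f x) \<omega> - dev n (f \<nu>) \<omega>\<bar> \<le> S \<omega>) \<and>
      expectation S \<le> M0 * (2 ^ Suc j * u) / sqrt (real n)"
    have "\<forall>j. \<exists>S. ?good j S"
    proof
      fix j
      show "\<exists>S. ?good j S"
      proof (cases "j \<in> J")
        case True
        have pos: "0 < 2 ^ Suc j * u" using u by simp
        then have le: "entropy_integral \<nu> (2 ^ Suc j * u) \<le> ennreal K'" using True ent by (simp add: J_def)
        obtain S where "integrable P S" "\<forall>\<omega>. 0 \<le> S \<omega>"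
          "\<forall>x\<in>ball \<nu> (2 ^ Suc j * u). \<forall>\<omega>. \<bar>dev n (f x) \<omega> - dev n (f \<nu>) \<omega>\<bar> \<le> S \<omega>"
          "expectation S \<le> (48 * K' + 1) * L * (2 ^ Suc j * u) / sqrt (real n)"
          using chaining_maximal_inequality[of f, OF meas bdd lip L pos le K'0 n] .
        then show ?thesis unfolding M0_def by blast
      qed simp
    qed
    from choice[OF this] obtain S where S: "\<And>j. ?good j (S j)" by auto
    define E where "E j = {\<omega>\<in>space P. S j \<omega> \<ge> C * (2 ^ j * u) powr \<kappa>}" for j
    have E: "E j \<in> sets P" if "j \<in> J" for j
    proof -
      have [measurable]: "S j \<in> borel_measurable P" using S[of j] that by auto
      show ?thesis unfolding E_def by measurable
    qed
    have prob_E: "prob (E j) \<le> 2 * M0 / (C * W) * q ^ j" if j: "j \<in> J" for j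
    proof -
      let ?t = "2 ^ j * u"
      have t: "?t > 0" using u by simp
      have "prob (E j) \<le> expectation (S j) / (C * ?t powr \<kappa>)"
        unfolding E_def using S[of j] j curvature(2) u
        by (intro integral_Markov_inequality_measure[where A = "{}"]) auto
      also have "\<dots> \<le> M0 * (2 ^ Suc j * u) / sqrt (real n) / (C * ?t powr \<kappa>)"
        using S[of j] j curvature(2) by (intro divide_right_mono) auto
      also have "\<dots> = 2 * M0 / C * (?t powr (1 - \<kappa>) / sqrt (real n))"
        using t by (simp add: powr_diff mult_ac)
      also have "?t powr (1 - \<kappa>) = q ^ j * (1 / W) * sqrt (real n)"
      proof -
        have "?t powr (1 - \<kappa>) = (2 ^ j) powr (1 - \<kappa>) * (K0 powr (1 - \<kappa>) * r powr (1 - \<kappa>))"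
          using K0 r by (simp add: u_def powr_mult)
        also have "(2 ^ j) powr (1 - \<kappa>) = q ^ j"
          by (simp add: q_def powr_powr mult.commute flip: powr_realpow)
        finally show ?thesis by (simp add: K0_powr r_powr)
      qed
      finally show ?thesis using n by (simp add: mult_ac)
    qed
    have "prob (\<Union>j\<in>J. E j) \<le> (\<Sum>j\<in>J. prob (E j))"
      using finJ E by (intro finite_measure_subadditive_finite) auto
    also have "\<dots> \<le> (\<Sum>j\<in>J. 2 * M0 / (C * W) * q ^ j)" by (intro sum_mono prob_E)
    also have "\<dots> = 2 * M0 / (C * W) * (\<Sum>j\<in>J. q ^ j)" by (simp add: sum_distrib_left)
    also have "\<dots> \<le> 2 * M0 / (C * W) * (1 / (1 - q))"
    proof (intro mult_left_mono)
      have "(\<Sum>j\<in>J. q ^ j) \<le> (\<Sum>j. q ^ j)"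
        using q finJ by (intro sum_le_suminf summable_geometric) auto
      also have "\<dots> = 1 / (1 - q)" using q by (intro suminf_geometric) auto
      finally show "(\<Sum>j\<in>J. q ^ j) \<le> 1 / (1 - q)" .
    qed (use M0 curvature(2) W in simp)
    also have "\<dots> = \<epsilon> / 2" using M0 curvature(2) \<epsilon> q by (simp add: W_def field_simps)
    finally have prob_U: "prob (\<Union>j\<in>J. E j) \<le> \<epsilon> / 2" .

    have U: "(\<Union>j\<in>J. E j) \<in> sets P" using E finJ by auto
    show "\<exists>E\<in>sets P. prob E \<le> \<epsilon> \<and>
      (\<forall>\<omega>\<in>space P - E. \<forall>x. (\<Sum>i<n. f x (X i \<omega>)) \<le> (\<Sum>i<n. f \<nu> (X i \<omega>)) \<longrightarrow>
         dist \<nu> x \<le> K0 * real n powr (- 1 / (2 * (\<kappa> - 1))))"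
    proof (intro bexI[of _ "E1 \<union> (\<Union>j\<in>J. E j)"] conjI ballI allI impI)
      show "E1 \<union> (\<Union>j\<in>J. E j) \<in> sets P" using U by auto
      show "prob (E1 \<union> (\<Union>j\<in>J. E j)) \<le> \<epsilon>"
        using measure_Un_le[OF E1 U] prob_E1 prob_U by linarith
      fix \<omega> x
      assume \<omega>: "\<omega> \<in> space P - (E1 \<union> (\<Union>j\<in>J. E j))"
        and le: "(\<Sum>i<n. f x (X i \<omega>)) \<le> (\<Sum>i<n. f \<nu> (X i \<omega>))"
      have "(\<Sum>i<n. f x (X i \<omega>)) / real n \<le> (\<Sum>i<n. f \<nu> (X i \<omega>)) / real n"
        using le by (intro divide_right_mono) auto
      then have basic: "F x - F \<nu> \<le> dev n (f \<nu>) \<omega> - dev n (f x) \<omega>"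
        by (simp add: dev_def F_def)
      have near: "dist \<nu> x \<le> \<rho>"
      proof (rule ccontr)
        assume "\<not> dist \<nu> x \<le> \<rho>"
        then have "b \<le> F x - F \<nu>" using b(2) by simp
        also note basic
        finally have "b \<le> 2 * (b / 4 + S1 \<omega>)"
          using S1(3)[rule_format, of x \<omega>] S1(3)[rule_format, of \<nu> \<omega>]
          unfolding abs_le_iff distrib_left by linarith
        then have "\<omega> \<in> E1" using \<omega> by (simp add: E1_def)
        then show False using \<omega> by simp
      qed
      have "dist \<nu> x \<le> u"
      proof (rule ccontr)
        assume "\<not> dist \<nu> x \<le> u"
        then have "u \<le> dist \<nu> x" by simp
        with u obtain j where j: "2 ^ j * u \<le> dist \<nu> x" "dist \<nu> x < 2 ^ Suc j * u"
          by (rule dyadic_shell)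
        have "(2::real) ^ j * u < 2 ^ m * u" using j(1) near m by linarith
        then have "j < m" using u by simp
        moreover have "2 ^ Suc j * u < \<delta>0" using j(1) near \<rho>(2) by simp
        ultimately have J: "j \<in> J" by (simp add: J_def)
        have "C * (2 ^ j * u) powr \<kappa> \<le> C * dist \<nu> x powr \<kappa>"
          using j(1) u \<kappa> curvature(2) by (intro mult_left_mono powr_mono2) auto
        also have "\<dots> \<le> F x - F \<nu>" using near \<rho>(3) by (intro curvature(3)) simp
        also have "\<dots> \<le> \<bar>dev n (f x) \<omega> - dev n (f \<nu>) \<omega>\<bar>" using basic by linarith
        also have "\<dots> \<le> S j \<omega>" using S[of j] J j(2) by simp
        finally have "\<omega> \<in> E j" using \<omega> by (simp add: E_def)
        then show False using \<omega> J by blast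
      qed
      then show "dist \<nu> x \<le> K0 * real n powr (- 1 / (2 * (\<kappa> - 1)))" by (simp add: u_def r_def)
    qed
  qed
qed

end

section \<open>Frechet means and the estimator\<close>

lemma outer_prob_le:
  assumes "E \<in> sets P" "S \<subseteq> E"
  shows "outer_prob P S \<le> measure P E"
  unfolding outer_prob_def
  by (rule cInf_lower) (use assms in \<open>auto intro!: bdd_belowI[of _ 0]\<close>)

context iid_sample
begin

lemma prob_no_sample_point_le:
  assumes G [measurable]: "G \<in> sets N" and p: "measure Q G > 0" and n: "n > 0"
  shows "\<exists>E\<in>sets P. prob E \<le> 3 / (measure Q G * sqrt (real n)) \<and> (\<forall>\<omega>\<in>space P - E. \<exists>i<n. X i \<omega> \<in> G)"
proof -
  let ?g = "indicator G :: 'b \<Rightarrow> real"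
  obtain S where S: "integrable P S" "\<forall>\<omega>. 0 \<le> S \<omega>" "\<forall>i\<in>{()}. \<forall>\<omega>. \<bar>dev n ?g \<omega>\<bar> \<le> S \<omega>"
    "expectation S \<le> 3 * 1 * sqrt (1 + ln 1) / sqrt (real n)"
    by (rule dev_family_dominated[of "{()}" 1 1 n "\<lambda>_. ?g"]) (use n in \<open>auto simp: indicator_def\<close>)
  have [measurable]: "S \<in> borel_measurable P" using S(1) by simp
  have "prob {\<omega>\<in>space P. S \<omega> \<ge> measure Q G} \<le> expectation S / measure Q G"
    using S p by (intro integral_Markov_inequality_measure[where A = "{}"]) auto
  also have "\<dots> \<le> 3 / sqrt (real n) / measure Q G"
    using S(4) p by (intro divide_right_mono) auto
  finally have "prob {\<omega>\<in>space P. S \<omega> \<ge> measure Q G} \<le> 3 / (measure Q G * sqrt (real n))"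
    by (simp add: mult.commute)
  moreover have "\<exists>i<n. X i \<omega> \<in> G" if "\<omega> \<in> space P - {\<omega>\<in>space P. S \<omega> \<ge> measure Q G}" for \<omega>
  proof (rule ccontr)
    assume "\<not> (\<exists>i<n. X i \<omega> \<in> G)"
    then have "dev n ?g \<omega> = - measure Q G" by (simp add: dev_def sets_law)
    then have "S \<omega> \<ge> measure Q G" using S(3)[rule_format, of "()" \<omega>] by simp
    then show False using that by simp
  qed
  ultimately show ?thesis by (intro bexI[of _ "{\<omega>\<in>space P. S \<omega> \<ge> measure Q G}"]) auto
qed

lemma sample_frechet_mean_rate:
  fixes Y :: "'b \<Rightarrow> 'm::metric_space" and G :: "'b set" and \<nu> :: 'm
  defines "f \<equiv> \<lambda>x z. indicator G z * (dist (Y z) x)\<^sup>2"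
  defines "H \<equiv> \<lambda>x. (\<integral>z. f x z \<partial>Q) / measure Q G"
  assumes Y [measurable]: "Y \<in> borel_measurable N" and G [measurable]: "G \<in> sets N" and p: "measure Q G > 0"
    and space: "bounded (UNIV::'m set)" "separable_space TYPE('m)"
    and separation: "\<And>e. e > 0 \<Longrightarrow> \<exists>b>H \<nu>. \<forall>x. dist \<nu> x > e \<longrightarrow> H x \<ge> b"
    and entropy: "eventually (\<lambda>\<delta>. entropy_integral \<nu> \<delta> \<le> ennreal K) (at_right 0)"
    and \<kappa>: "\<kappa> > 1"
    and curvature: "\<exists>\<eta>>0. \<exists>C>0. \<forall>x. dist \<nu> x < \<eta> \<longrightarrow> H x - H \<nu> \<ge> C * dist \<nu> x powr \<kappa>"
    and \<epsilon>: "\<epsilon> > 0"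
  shows "\<exists>K n0. K \<ge> 0 \<and> (\<forall>n\<ge>n0. \<exists>E\<in>sets P. prob E \<le> \<epsilon> \<and>
    (\<forall>\<omega>\<in>space P - E. (\<exists>i<n. X i \<omega> \<in> G) \<and>
      (\<forall>x. (\<Sum>i<n. f x (X i \<omega>)) \<le> (\<Sum>i<n. f \<nu> (X i \<omega>)) \<longrightarrow>
         dist \<nu> x \<le> K * real n powr (- 1 / (2 * (\<kappa> - 1))))))"
proof -
  obtain B0 where B0: "\<And>a b::'m. dist a b \<le> B0"
    using space(1) unfolding bounded_two_points by blast
  define B where "B = max B0 1"
  have B: "B > 0" "\<And>a b::'m. dist a b \<le> B" using B0 by (auto simp: B_def intro: le_max_iff_disj[THEN iffD2])
  have F: "(\<integral>z. f x z \<partial>Q) = measure Q G * H x" for x using p by (simp add: H_def)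
  obtain \<eta> C where \<eta>: "\<eta> > 0" and C: "C > 0"
    and curv: "\<And>x. dist \<nu> x < \<eta> \<Longrightarrow> H x - H \<nu> \<ge> C * dist \<nu> x powr \<kappa>"
    using curvature by blast
  have "\<exists>K n0. K \<ge> 0 \<and> (\<forall>n\<ge>n0. \<exists>E\<in>sets P. prob E \<le> \<epsilon> / 2 \<and>
    (\<forall>\<omega>\<in>space P - E. \<forall>x. (\<Sum>i<n. f x (X i \<omega>)) \<le> (\<Sum>i<n. f \<nu> (X i \<omega>)) \<longrightarrow>
       dist \<nu> x \<le> K * real n powr (- 1 / (2 * (\<kappa> - 1)))))"
  proof (rule m_estimator_rate[where B = "B\<^sup>2" and L = "2 * B" and \<eta> = \<eta> and C = "measure Q G * C", OF _ _ _ _ _ _ entropy \<kappa>])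
    show "f x \<in> borel_measurable N" for x unfolding f_def by measurable
    have "(dist a b)\<^sup>2 \<le> B\<^sup>2" for a b :: 'm using B by (intro power_mono) auto
    then show "\<bar>f x z\<bar> \<le> B\<^sup>2" for x z by (auto simp: f_def indicator_def)
    have "\<bar>(dist a x)\<^sup>2 - (dist a y)\<^sup>2\<bar> \<le> 2 * B * dist x y" for a x y :: 'm
      using B(2) abs_dist_diff_le[of x a y]
      by (intro abs_power2_diff_le) (auto simp: dist_commute[of x a])
    then show "\<bar>f x z - f y z\<bar> \<le> 2 * B * dist x y" for x y z
      using B(1) by (auto simp: f_def indicator_def)
    show "0 < 2 * B" using B by simp
    show "\<exists>A\<ge>0. \<forall>n>0. \<exists>S. integrable P S \<and> (\<forall>\<omega>. 0 \<le> S \<omega>) \<and>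
      (\<forall>x \<omega>. \<bar>dev n (f x) \<omega>\<bar> \<le> e + S \<omega>) \<and> expectation S \<le> A / sqrt (real n)" if "e > 0" for e
      unfolding f_def by (rule uniform_law_of_large_numbers_dist[OF Y G space(2) B that])
    show "\<exists>b>0. \<forall>x. dist \<nu> x > e \<longrightarrow> (\<integral>z. f x z \<partial>Q) - (\<integral>z. f \<nu> z \<partial>Q) \<ge> b" if e: "e > 0" for e
    proof -
      obtain b where b: "b > H \<nu>" "\<And>x. dist \<nu> x > e \<Longrightarrow> H x \<ge> b" using separation[OF e] by blast
      have "measure Q G * (b - H \<nu>) \<le> measure Q G * H x - measure Q G * H \<nu>" if "dist \<nu> x > e" for x
        using b(2)[OF that] p by (simp flip: right_diff_distrib)
      then show ?thesis using b(1) p unfolding F by (intro exI[of _ "measure Q G * (b - H \<nu>)"]) simp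
    qed
    show "measure Q G * C * dist \<nu> x powr \<kappa> \<le> (\<integral>z. f x z \<partial>Q) - (\<integral>z. f \<nu> z \<partial>Q)"
      if "dist \<nu> x < \<eta>" for x
      using mult_left_mono[OF curv[OF that], of "measure Q G"] p unfolding F
      by (simp add: right_diff_distrib mult_ac)
  qed (use \<eta> C p \<epsilon> in auto)
  then obtain K n1 where K: "K \<ge> 0" and rate: "\<And>n. n \<ge> n1 \<Longrightarrow> \<exists>E\<in>sets P. prob E \<le> \<epsilon> / 2 \<and>
    (\<forall>\<omega>\<in>space P - E. \<forall>x. (\<Sum>i<n. f x (X i \<omega>)) \<le> (\<Sum>i<n. f \<nu> (X i \<omega>)) \<longrightarrow>
       dist \<nu> x \<le> K * real n powr (- 1 / (2 * (\<kappa> - 1))))" by blast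
  define n2 where "n2 = Suc (nat \<lceil>(6 / (measure Q G * \<epsilon>))\<^sup>2\<rceil>)"
  show ?thesis
  proof (intro exI[of _ K] exI[of _ "max n1 n2"] conjI K allI impI)
    fix n assume "n \<ge> max n1 n2"
    then have n: "n \<ge> n1" "n \<ge> n2" "n > 0" by (auto simp: n2_def)
    obtain E1 where E1: "E1 \<in> sets P" "prob E1 \<le> \<epsilon> / 2"
      "\<And>\<omega> x. \<omega> \<in> space P - E1 \<Longrightarrow> (\<Sum>i<n. f x (X i \<omega>)) \<le> (\<Sum>i<n. f \<nu> (X i \<omega>)) \<Longrightarrow>
       dist \<nu> x \<le> K * real n powr (- 1 / (2 * (\<kappa> - 1)))"
      using rate[OF n(1)] by blast
    obtain E2 where E2: "E2 \<in> sets P" "prob E2 \<le> 3 / (measure Q G * sqrt (real n))"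
      "\<And>\<omega>. \<omega> \<in> space P - E2 \<Longrightarrow> \<exists>i<n. X i \<omega> \<in> G"
      using prob_no_sample_point_le[OF G p n(3)] by blast
    have "6 / (measure Q G * \<epsilon>) \<le> sqrt (real n)"
    proof (rule real_le_rsqrt)
      have "(6 / (measure Q G * \<epsilon>))\<^sup>2 \<le> real (nat \<lceil>(6 / (measure Q G * \<epsilon>))\<^sup>2\<rceil>)" by (rule real_nat_ceiling_ge)
      also have "\<dots> \<le> real n" using n(2) by (simp add: n2_def)
      finally show "(6 / (measure Q G * \<epsilon>))\<^sup>2 \<le> real n" .
    qed
    then have "6 \<le> sqrt (real n) * (measure Q G * \<epsilon>)" using p \<epsilon> by (simp add: pos_divide_le_eq)
    then have "3 / (measure Q G * sqrt (real n)) \<le> \<epsilon> / 2"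
      using p n(3) by (simp add: pos_divide_le_eq mult_ac)
    then have "prob (E1 \<union> E2) \<le> \<epsilon>"
      using measure_Un_le[OF E1(1) E2(1)] E1(2) E2(2) by linarith
    then show "\<exists>E\<in>sets P. prob E \<le> \<epsilon> \<and>
      (\<forall>\<omega>\<in>space P - E. (\<exists>i<n. X i \<omega> \<in> G) \<and>
        (\<forall>x. (\<Sum>i<n. f x (X i \<omega>)) \<le> (\<Sum>i<n. f \<nu> (X i \<omega>)) \<longrightarrow>
           dist \<nu> x \<le> K * real n powr (- 1 / (2 * (\<kappa> - 1)))))"
      using E1 E2 by (intro bexI[of _ "E1 \<union> E2"]) auto
  qed
qed

end

theorem theorem4p1:
  fixes \<Gamma> :: "'m::metric_space \<Rightarrow> 'm \<Rightarrow> 'm \<Rightarrow> 'm"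
    and P :: "'a measure"
    and D :: "'a \<Rightarrow> bool"
    and Y00 Y10 Y11 :: "'a \<Rightarrow> 'm"
    and Xs :: "nat \<Rightarrow> 'a \<Rightarrow> 'm \<times> 'm \<times> bool"
    and \<kappa> C1 C2 c :: real
  defines "Nobs \<equiv> (borel \<Otimes>\<^sub>M (borel \<Otimes>\<^sub>M count_space (UNIV::bool set))) :: ('m \<times> 'm \<times> bool) measure"
    and "\<nu>po \<equiv> \<lambda>g Y. frechet_argmin (cond_frechet_obj P D g Y)"
    and "\<nu> \<equiv> \<lambda>g t. frechet_argmin (cond_frechet_obj P D g (obs_Y D Y00 Y10 Y11 t))"
    and "\<nu>hat \<equiv> \<lambda>n g t \<omega>. frechet_argmin (sample_obj (sample_Y Xs t) (sample_D Xs) n g \<omega>)"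
  assumes space: "bounded (UNIV::'m set)" "separable_space TYPE('m)"
      "unique_geodesic_space TYPE('m)"
    and prob: "prob_space P"
    and meas: "D \<in> measurable P (count_space UNIV)"
      "Y00 \<in> borel_measurable P" "Y10 \<in> borel_measurable P" "Y11 \<in> borel_measurable P"
    and sample: "\<And>i. Xs i \<in> measurable P Nobs"
      "prob_space.indep_vars P (\<lambda>_. Nobs) Xs UNIV"
      "\<And>i. distr P Nobs (Xs i) = distr P Nobs (\<lambda>\<omega>. (obs_Y D Y00 Y10 Y11 False \<omega>, obs_Y D Y00 Y10 Y11 True \<omega>, D \<omega>))"
    and parallel_trends:
      "\<Gamma> (\<nu>po False Y00) (\<nu>po False Y10) (\<nu>po True Y00) = \<nu>po True Y10"
    and lip1: "C1 > 0" "\<And>a b w z. dist (\<Gamma> a b w) (\<Gamma> a b z) \<le> C1 * dist w z"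
    and lip2: "C2 > 0" "\<And>a1 a2 b1 b2 w.
        dist (\<Gamma> a1 b1 w) (\<Gamma> a2 b2 w) \<le> C2 * (dist a1 a2 + dist b1 b2)"
    and exist_pop: "\<And>g t. \<exists>!x. \<forall>y. cond_frechet_obj P D g (obs_Y D Y00 Y10 Y11 t) x \<le> cond_frechet_obj P D g (obs_Y D Y00 Y10 Y11 t) y"
    and exist_sample: "\<And>g t n. AE \<omega> in P. card {i. i < n \<and> sample_D Xs i \<omega> = g} > 0 \<longrightarrow>
        (\<exists>!x. \<forall>y. sample_obj (sample_Y Xs t) (sample_D Xs) n g \<omega> x \<le> sample_obj (sample_Y Xs t) (sample_D Xs) n g \<omega> y)"
    and separation: "\<And>g t \<epsilon>. \<epsilon> > 0 \<Longrightarrow> \<exists>b > cond_frechet_obj P D g (obs_Y D Y00 Y10 Y11 t) (\<nu> g t).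
        \<forall>x. dist (\<nu> g t) x > \<epsilon> \<longrightarrow> cond_frechet_obj P D g (obs_Y D Y00 Y10 Y11 t) x \<ge> b"
    and entropy: "\<And>g t. \<exists>K::real. eventually (\<lambda>\<delta>. entropy_integral (\<nu> g t) \<delta> \<le> ennreal K) (at_right 0)"
    and kappa: "\<kappa> > 1"
    and curvature: "\<And>g t. \<exists>\<eta>>0. \<exists>C>0. \<forall>x. dist (\<nu> g t) x < \<eta> \<longrightarrow>
        cond_frechet_obj P D g (obs_Y D Y00 Y10 Y11 t) x - cond_frechet_obj P D g (obs_Y D Y00 Y10 Y11 t) (\<nu> g t) \<ge> C * dist (\<nu> g t) x powr \<kappa>"
    and overlap: "0 < c" "c \<le> 1/2" "c \<le> measure P {\<omega>\<in>space P. D \<omega>}"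
      "measure P {\<omega>\<in>space P. D \<omega>} \<le> 1 - c"
  shows "bigOp P
     (\<lambda>n \<omega>. dG \<Gamma> (\<Gamma> (\<nu> False False) (\<nu> False True) (\<nu> True False))
        (\<Gamma> (\<nu>hat n False False \<omega>) (\<nu>hat n False True \<omega>) (\<nu>hat n True False \<omega>), \<nu>hat n True True \<omega>)
        (\<nu>po True Y10, \<nu>po True Y11))
     (\<lambda>n. real n powr (- 1 / (2 * (\<kappa> - 1))))"
proof -
  interpret prob_space P by (rule prob)
  define Yt :: "bool \<Rightarrow> 'm \<times> 'm \<times> bool \<Rightarrow> 'm" where "Yt t z = (if t then fst (snd z) else fst z)" for t z
  define G :: "bool \<Rightarrow> ('m \<times> 'm \<times> bool) set" where "G g = {z. snd (snd z) = g}" for g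
  define obs where "obs \<omega> = (obs_Y D Y00 Y10 Y11 False \<omega>, obs_Y D Y00 Y10 Y11 True \<omega>, D \<omega>)" for \<omega>
  note meas [measurable]
  have obsY [measurable]: "obs_Y D Y00 Y10 Y11 t \<in> borel_measurable P" for t
  proof (cases t)
    case True
    have "{\<omega>\<in>space P. D \<omega>} \<in> sets P" by measurable
    then have "(\<lambda>\<omega>. if D \<omega> then Y11 \<omega> else Y10 \<omega>) \<in> borel_measurable P"
      by (intro measurable_If meas)
    then show ?thesis using True by (simp add: obs_Y_def[abs_def])
  qed (simp add: obs_Y_def[abs_def] meas)
  have obs [measurable]: "obs \<in> measurable P Nobs"
    unfolding obs_def[abs_def] Nobs_def by (intro measurable_Pair obsY meas)
  define Q where "Q = distr P Nobs obs"
  interpret iid_sample P Nobs Q Xs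
    by unfold_locales (use sample in \<open>auto simp: Q_def obs_def[abs_def]\<close>)
  have space_Nobs: "space Nobs = UNIV" by (simp add: Nobs_def space_pair_measure)
  have Yt: "Yt t \<in> borel_measurable Nobs" for t
    unfolding Yt_def[abs_def] Nobs_def by (cases t) simp_all
  have G: "G g \<in> sets Nobs" for g
  proof -
    have "(\<lambda>z. snd (snd z)) \<in> measurable Nobs (count_space (UNIV::bool set))"
      unfolding Nobs_def by measurable
    from measurable_sets[OF this, of "{g}"] show ?thesis
      by (simp add: G_def space_Nobs vimage_def)
  qed
  have Dg: "{\<omega>\<in>space P. D \<omega> = g} \<in> sets P" for g by measurable
  have law_G: "measure Q (G g) = measure P {\<omega>\<in>space P. D \<omega> = g}" for g
    unfolding Q_def measure_distr[OF obs G]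
    by (rule arg_cong[where f = "measure P"]) (auto simp: G_def obs_def)
  have p: "measure Q (G g) > 0" for g
  proof (cases g)
    case True
    then show ?thesis using overlap law_G by simp
  next
    case False
    have "prob (space P - {\<omega>\<in>space P. D \<omega>}) = 1 - prob {\<omega>\<in>space P. D \<omega>}"
      by (rule prob_compl) measurable
    moreover have "space P - {\<omega>\<in>space P. D \<omega>} = {\<omega>\<in>space P. D \<omega> = False}" by auto
    ultimately show ?thesis using False overlap law_G[of False] by simp
  qed
  let ?f = "\<lambda>g t x z. indicator (G g) z * (dist (Yt t z) x)\<^sup>2 :: real"
  have obj: "(\<integral>z. ?f g t x z \<partial>Q) / measure Q (G g) = cond_frechet_obj P D g (obs_Y D Y00 Y10 Y11 t) x" for g t x
  proof -
    have "?f g t x \<in> borel_measurable Nobs" using Yt G by measurable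
    then have "(\<integral>z. ?f g t x z \<partial>Q) = (\<integral>\<omega>. ?f g t x (obs \<omega>) \<partial>P)"
      unfolding Q_def by (intro integral_distr obs)
    also have "\<dots> = (\<integral>\<omega>. indicator {\<omega>\<in>space P. D \<omega> = g} \<omega> * (dist (obs_Y D Y00 Y10 Y11 t \<omega>) x)\<^sup>2 \<partial>P)"
      by (intro Bochner_Integration.integral_cong) (auto simp: indicator_def G_def obs_def Yt_def)
    finally show ?thesis by (simp add: cond_frechet_obj_def cond_mean_D_def law_G)
  qed
  have sample_sum: "sample_obj (sample_Y Xs t) (sample_D Xs) n g \<omega> x =
      (1 / real (card {i. i < n \<and> sample_D Xs i \<omega> = g})) * (\<Sum>i<n. ?f g t x (Xs i \<omega>))" for n g t \<omega> x
    unfolding sample_obj_def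
    by (intro arg_cong2[where f = "(*)"] sum.cong refl)
      (auto simp: indicator_def G_def sample_D_def sample_Y_def Yt_def)
  let ?r = "\<lambda>n. real n powr (- 1 / (2 * (\<kappa> - 1)))"
  have rate: "\<exists>K n0. K \<ge> 0 \<and> (\<forall>n\<ge>n0. \<exists>E\<in>sets P. prob E \<le> \<epsilon> \<and>
      (\<forall>\<omega>\<in>space P - E. dist (\<nu> g t) (\<nu>hat n g t \<omega>) \<le> K * ?r n))" if "\<epsilon> > 0" for \<epsilon> g t
  proof -
    from entropy obtain K1 where K1: "eventually (\<lambda>\<delta>. entropy_integral (\<nu> g t) \<delta> \<le> ennreal K1) (at_right 0)"
      by blast
    have "\<exists>K n0. K \<ge> 0 \<and> (\<forall>n\<ge>n0. \<exists>E\<in>sets P. prob E \<le> \<epsilon> \<and>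
      (\<forall>\<omega>\<in>space P - E. (\<exists>i<n. Xs i \<omega> \<in> G g) \<and>
        (\<forall>x. (\<Sum>i<n. ?f g t x (Xs i \<omega>)) \<le> (\<Sum>i<n. ?f g t (\<nu> g t) (Xs i \<omega>)) \<longrightarrow>
           dist (\<nu> g t) x \<le> K * ?r n)))"
      by (rule sample_frechet_mean_rate[OF Yt G p space(1,2) _ K1 kappa _ that])
        (unfold obj, rule separation, assumption, rule curvature)
    then obtain K n0 where K: "K \<ge> 0" and E: "\<And>n. n \<ge> n0 \<Longrightarrow> \<exists>E\<in>sets P. prob E \<le> \<epsilon> \<and>
      (\<forall>\<omega>\<in>space P - E. (\<exists>i<n. Xs i \<omega> \<in> G g) \<and>
        (\<forall>x. (\<Sum>i<n. ?f g t x (Xs i \<omega>)) \<le> (\<Sum>i<n. ?f g t (\<nu> g t) (Xs i \<omega>)) \<longrightarrow>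
           dist (\<nu> g t) x \<le> K * ?r n))" by blast
    show ?thesis
    proof (intro exI[of _ K] exI[of _ n0] conjI K allI impI)
      fix n assume "n \<ge> n0"
      from E[OF this] obtain E where E: "E \<in> sets P" "prob E \<le> \<epsilon>"
        "\<forall>\<omega>\<in>space P - E. (\<exists>i<n. Xs i \<omega> \<in> G g) \<and>
          (\<forall>x. (\<Sum>i<n. ?f g t x (Xs i \<omega>)) \<le> (\<Sum>i<n. ?f g t (\<nu> g t) (Xs i \<omega>)) \<longrightarrow>
             dist (\<nu> g t) x \<le> K * ?r n)" by blast
      from AE_E[OF exist_sample[of n g t]] obtain Z where Z:
        "{\<omega> \<in> space P. \<not> (card {i. i < n \<and> sample_D Xs i \<omega> = g} > 0 \<longrightarrow>
          (\<exists>!x. \<forall>y. sample_obj (sample_Y Xs t) (sample_D Xs) n g \<omega> x \<le> sample_obj (sample_Y Xs t) (sample_D Xs) n g \<omega> y))} \<subseteq> Z"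
        "emeasure P Z = 0" "Z \<in> sets P" .
      show "\<exists>E\<in>sets P. prob E \<le> \<epsilon> \<and> (\<forall>\<omega>\<in>space P - E. dist (\<nu> g t) (\<nu>hat n g t \<omega>) \<le> K * ?r n)"
      proof (intro bexI[of _ "E \<union> Z"] conjI ballI)
        show "E \<union> Z \<in> sets P" using E Z by auto
        have "prob Z = 0" using Z(2) by (simp add: measure_def)
        then show "prob (E \<union> Z) \<le> \<epsilon>"
          using measure_Un_le[OF E(1) Z(3)] E(2) by linarith
        fix \<omega> assume \<omega>: "\<omega> \<in> space P - (E \<union> Z)"
        let ?I = "{i. i < n \<and> sample_D Xs i \<omega> = g}"
        obtain i where "i < n" "Xs i \<omega> \<in> G g" using E(3) \<omega> by blast
        then have "i \<in> ?I" by (simp add: G_def sample_D_def)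
        then have card: "card ?I > 0" by (auto simp: card_gt_0_iff)
        then have "\<exists>!x. \<forall>y. sample_obj (sample_Y Xs t) (sample_D Xs) n g \<omega> x \<le> sample_obj (sample_Y Xs t) (sample_D Xs) n g \<omega> y"
          using Z(1) \<omega> by blast
        from theI'[OF this]
        have "sample_obj (sample_Y Xs t) (sample_D Xs) n g \<omega> (\<nu>hat n g t \<omega>) \<le>
            sample_obj (sample_Y Xs t) (sample_D Xs) n g \<omega> (\<nu> g t)"
          unfolding \<nu>hat_def frechet_argmin_def by blast
        then have "(\<Sum>i<n. ?f g t (\<nu>hat n g t \<omega>) (Xs i \<omega>)) \<le> (\<Sum>i<n. ?f g t (\<nu> g t) (Xs i \<omega>))"
          unfolding sample_sum using card by (simp add: divide_le_cancel)
        then show "dist (\<nu> g t) (\<nu>hat n g t \<omega>) \<le> K * ?r n" using E(3) \<omega> by blast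
      qed
    qed
  qed
  have Y00: "\<nu>po g Y00 = \<nu> g False" for g
  proof -
    have "obs_Y D Y00 Y10 Y11 False = Y00" by (simp add: obs_Y_def fun_eq_iff)
    then show ?thesis by (simp add: \<nu>po_def \<nu>_def)
  qed
  have Y1: "\<nu>po g (if g then Y11 else Y10) = \<nu> g True" for g
  proof -
    have "cond_frechet_obj P D g (if g then Y11 else Y10) x = cond_frechet_obj P D g (obs_Y D Y00 Y10 Y11 True) x" for x
      unfolding cond_frechet_obj_def cond_mean_D_def
      by (intro arg_cong2[where f = "(/)"] Bochner_Integration.integral_cong refl)
        (auto simp: indicator_def obs_Y_def)
    then have "cond_frechet_obj P D g (if g then Y11 else Y10) = cond_frechet_obj P D g (obs_Y D Y00 Y10 Y11 True)"
      by (rule ext)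
    then show ?thesis by (simp only: \<nu>po_def \<nu>_def)
  qed
  have Y11: "\<nu>po True Y11 = \<nu> True True" and Y10: "\<nu>po False Y10 = \<nu> False True"
    using Y1[of True] Y1[of False] by simp_all
  have cf: "\<nu>po True Y10 = \<Gamma> (\<nu> False False) (\<nu> False True) (\<nu> True False)"
    using parallel_trends by (simp add: Y00 Y10)
  let ?e = "\<lambda>n \<omega> g t. dist (\<nu> g t) (\<nu>hat n g t \<omega>)"
  let ?X = "\<lambda>n \<omega>. dG \<Gamma> (\<Gamma> (\<nu> False False) (\<nu> False True) (\<nu> True False))
        (\<Gamma> (\<nu>hat n False False \<omega>) (\<nu>hat n False True \<omega>) (\<nu>hat n True False \<omega>), \<nu>hat n True True \<omega>)
        (\<nu>po True Y10, \<nu>po True Y11)"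
  have bound: "\<bar>?X n \<omega>\<bar> \<le> C2 * (C2 * (?e n \<omega> False False + ?e n \<omega> False True) + C1 * ?e n \<omega> True False + ?e n \<omega> True True)"
    for n \<omega>
  proof -
    let ?a = "\<nu>hat n False False \<omega>" and ?b = "\<nu>hat n False True \<omega>" and ?w = "\<nu>hat n True False \<omega>"
    have "dist (\<Gamma> ?a ?b ?w) (\<nu>po True Y10) \<le> dist (\<Gamma> ?a ?b ?w) (\<Gamma> ?a ?b (\<nu> True False)) +
        dist (\<Gamma> ?a ?b (\<nu> True False)) (\<Gamma> (\<nu> False False) (\<nu> False True) (\<nu> True False))"
      unfolding cf by (rule dist_triangle)
    also have "\<dots> \<le> C1 * ?e n \<omega> True False + C2 * (?e n \<omega> False False + ?e n \<omega> False True)"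
      using lip1(2)[of ?a ?b ?w "\<nu> True False"]
        lip2(2)[of ?a ?b "\<nu> True False" "\<nu> False False" "\<nu> False True"]
      by (simp add: dist_commute)
    finally have "dist (\<Gamma> ?a ?b ?w) (\<nu>po True Y10) + dist (\<nu>hat n True True \<omega>) (\<nu>po True Y11)
        \<le> C2 * (?e n \<omega> False False + ?e n \<omega> False True) + C1 * ?e n \<omega> True False + ?e n \<omega> True True"
      by (simp add: Y11 dist_commute)
    then have "C2 * (dist (\<Gamma> ?a ?b ?w) (\<nu>po True Y10) + dist (\<nu>hat n True True \<omega>) (\<nu>po True Y11))
        \<le> C2 * (C2 * (?e n \<omega> False False + ?e n \<omega> False True) + C1 * ?e n \<omega> True False + ?e n \<omega> True True)"
      using lip2(1) by (intro mult_left_mono) auto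
    moreover have "\<bar>?X n \<omega>\<bar> \<le> C2 * (dist (\<Gamma> ?a ?b ?w) (\<nu>po True Y10) + dist (\<nu>hat n True True \<omega>) (\<nu>po True Y11))"
      using lip2(2) by (simp add: dG_def)
    ultimately show ?thesis by linarith
  qed
  show ?thesis
    unfolding bigOp_def
  proof (intro allI impI)
    fix \<epsilon> :: real assume "\<epsilon> > 0"
    then have "\<epsilon> / 4 > 0" by simp
    note rates = rate[OF this]
    have "\<forall>gt. \<exists>K n0. K \<ge> 0 \<and> (\<forall>n\<ge>n0. \<exists>E\<in>sets P. prob E \<le> \<epsilon> / 4 \<and>
        (\<forall>\<omega>\<in>space P - E. ?e n \<omega> (fst gt) (snd gt) \<le> K * ?r n))"
      using rates by blast
    then obtain K n0 where Kn0: "\<And>gt n. n \<ge> n0 gt \<Longrightarrow> \<exists>E\<in>sets P. prob E \<le> \<epsilon> / 4 \<and>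
        (\<forall>\<omega>\<in>space P - E. ?e n \<omega> (fst gt) (snd gt) \<le> K gt * ?r n)"
      by metis
    let ?K = "C2 * (C2 * (K (False, False) + K (False, True)) + C1 * K (True, False) + K (True, True))"
    let ?n = "Max (range n0)"
    show "\<exists>K N. \<forall>n\<ge>N. outer_prob P {\<omega> \<in> space P. \<bar>?X n \<omega>\<bar> > K * ?r n} \<le> \<epsilon>"
    proof (intro exI[of _ ?K] exI[of _ ?n] allI impI)
      fix n assume "n \<ge> ?n"
      then have "n \<ge> n0 gt" for gt by (cases gt) simp
      then have "\<forall>gt. \<exists>E. E \<in> sets P \<and> prob E \<le> \<epsilon> / 4 \<and> (\<forall>\<omega>\<in>space P - E. ?e n \<omega> (fst gt) (snd gt) \<le> K gt * ?r n)"
        using Kn0 by blast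
      from choice[OF this] obtain E where E: "\<And>gt. E gt \<in> sets P" "\<And>gt. prob (E gt) \<le> \<epsilon> / 4"
        "\<And>gt \<omega>. \<omega> \<in> space P - E gt \<Longrightarrow> ?e n \<omega> (fst gt) (snd gt) \<le> K gt * ?r n" by blast
      have "{\<omega> \<in> space P. \<bar>?X n \<omega>\<bar> > ?K * ?r n} \<subseteq> (\<Union>gt. E gt)"
      proof (rule ccontr)
        assume "\<not> ?thesis"
        then obtain \<omega> where \<omega>: "\<omega> \<in> space P" "\<bar>?X n \<omega>\<bar> > ?K * ?r n" "\<And>gt. \<omega> \<notin> E gt" by blast
        have e: "?e n \<omega> g t \<le> K (g, t) * ?r n" for g t using E(3)[of \<omega> "(g, t)"] \<omega> by simp
        have "\<bar>?X n \<omega>\<bar> \<le> C2 * (C2 * (?e n \<omega> False False + ?e n \<omega> False True) + C1 * ?e n \<omega> True False + ?e n \<omega> True True)"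
          by (rule bound)
        also have "\<dots> \<le> C2 * (C2 * (K (False, False) * ?r n + K (False, True) * ?r n) +
            C1 * (K (True, False) * ?r n) + K (True, True) * ?r n)"
          using lip1(1) lip2(1) by (intro mult_left_mono add_mono e) auto
        also have "\<dots> = ?K * ?r n" by (simp add: algebra_simps)
        finally show False using \<omega>(2) by simp
      qed
      then have "outer_prob P {\<omega> \<in> space P. \<bar>?X n \<omega>\<bar> > ?K * ?r n} \<le> prob (\<Union>gt. E gt)"
        using E(1) by (intro outer_prob_le) auto
      also have "\<dots> \<le> (\<Sum>gt\<in>UNIV. prob (E gt))"
        using E(1) by (intro finite_measure_subadditive_finite) auto
      also have "\<dots> \<le> (\<Sum>gt\<in>(UNIV :: (bool \<times> bool) set). \<epsilon> / 4)" by (intro sum_mono E)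
      also have "\<dots> = \<epsilon>" by simp
      finally show "outer_prob P {\<omega> \<in> space P. \<bar>?X n \<omega>\<bar> > ?K * ?r n} \<le> \<epsilon>" .
    qed
  qed
qed

end
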